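(* Let $\Omega\subset\mathbf{S}^{n+1}$ be any nonempty open set (with $\partial\Omega\neq\varnothing$) and let $0<s<t<\pi$. Then there exists a countable collection $\{\mathcal{U}_j\}_{j\ge 1}$ of compact subsets of $\Gamma_s^t$ such that $\mathcal{H}^n\big(\Gamma_s^t\setminus\bigcup_{j=1}^\infty\mathcal{U}_j\big)=0$, with each $\mathcal{U}_j$ contained in a $C^{1,1}$-hypersurface of $\mathbf{S}^{n+1}$. Moreover, denoting by $N$ the gradient of the distance function $u(\cdot)=\mathrm{dist}_g(\cdot,\partial\Omega)$, the restriction $N|_{\mathcal{U}_j}$ is Lipschitz for every $j\ge1$.
   Context: $\mathbf{S}^{n+1}\subset\mathbf{R}^{n+2}$ is the unit sphere with the round metric induced by the Euclidean metric (sectional curvature $1$), and $\mathrm{dist}_g$ is its geodesic distance. $\mathcal{H}^n$ is the $n$-dimensional Hausdorff measure in $\mathbf{R}^{n+2}$. For a nonempty open set $\Omega\subset\mathbf{S}^{n+1}$, $\partial\Omega$ is its topological boundary in $\mathbf{S}^{n+1}$ and $u(y)=\mathrm{dist}_g(y,\partial\Omega)$. For $0<s<t<\pi$, $\Gamma_s^t$ is the set of points $y\in\Omega$ such that (1) $\mathrm{dist}_g(y,\partial\Omega)=s$, and (2) there exists a unit-speed geodesic $\gamma_y:[s-t,s]\to\mathbf{S}^{n+1}$ with $\gamma_y(0)=y$ and $\mathrm{dist}_g(\gamma_y(r),\partial\Omega)=s-r$ for every $r\in[s-t,s]$. The function $u$ is differentiable at every point of $\Gamma_s^t$, and $N(y)\in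 T_y\mathbf{S}^{n+1}\subset\mathbf{R}^{n+2}$ denotes its gradient at $y\in\Gamma_s^t$, regarded as a vector in $\mathbf{R}^{n+2}$. "Lipschitz" refers to $N$ as a map into $\mathbf{R}^{n+2}$. *)

theory Defs
  imports "HOL-Analysis.Analysis"
begin

section \<open>Hausdorff measure\<close>

text \<open>The diameter of an unbounded set is not meaningful in the library, so only bounded covering
  sets are allowed. For \<open>d = 0\<close> a nonempty covering set counts \<open>0 ^ 0 = 1\<close>, and
  the empty set has to be excluded by hand.\<close>

definition hausdorff_premeasure :: "nat \<Rightarrow> real \<Rightarrow> 'a::metric_space set \<Rightarrow> ennreal" where
  "hausdorff_premeasure d \<delta> A =
    (INF E \<in> {E :: nat \<Rightarrow> 'a set. A \<subseteq> (\<Union>i. E i) \<and> (\<forall>i. bounded (E i) \<and> diameter (E i) \<le> \<delta>)}.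
      \<Sum>i. if E i = {} then 0 else ennreal (unit_ball_vol (real d) * (diameter (E i) / 2) ^ d))"

definition hausdorff_measure :: "nat \<Rightarrow> 'a::metric_space set \<Rightarrow> ennreal" where
  "hausdorff_measure d A = (SUP \<delta> \<in> {0<..}. hausdorff_premeasure d \<delta> A)"

section \<open>The round unit sphere\<close>

abbreviation unit_sphere :: "'a::euclidean_space set" where
  "unit_sphere \<equiv> sphere 0 1"

text \<open>The infimum of the lengths of piecewise \<open>C\<^sup>1\<close> curves in the sphere. A
  \<^const>\<open>valid_path\<close> may have an unbounded derivative near a break point; asking for
  \<^const>\<open>has_integral\<close> discards the curves whose length is infinite.\<close>

definition sphere_dist :: "'a::euclidean_space \<Rightarrow> 'a \<Rightarrow> real" where
  "sphere_dist x y =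
    Inf {L. \<exists>g. valid_path g \<and> path_image g \<subseteq> unit_sphere \<and> pathstart g = x \<and> pathfinish g = y \<and>
                ((\<lambda>t. norm (vector_derivative g (at t))) has_integral L) {0..1}}"

text \<open>Used for nonempty \<open>A\<close> only.\<close>

definition sphere_infdist :: "'a::euclidean_space \<Rightarrow> 'a set \<Rightarrow> real" where
  "sphere_infdist y A = (INF a\<in>A. sphere_dist y a)"

text \<open>The covariant acceleration of a curve in the sphere is the orthogonal projection of
  its second derivative to the tangent space.\<close>

definition unit_speed_geodesic_on :: "real set \<Rightarrow> (real \<Rightarrow> 'a::euclidean_space) \<Rightarrow> bool" where
  "unit_speed_geodesic_on I \<gamma> \<longleftrightarrow>
    (\<exists>\<gamma>' \<gamma>''. \<forall>r\<in>I.
        \<gamma> r \<in> unit_sphere \<and>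
        (\<gamma> has_vector_derivative \<gamma>' r) (at r within I) \<and>
        (\<gamma>' has_vector_derivative \<gamma>'' r) (at r within I) \<and>
        norm (\<gamma>' r) = 1 \<and>
        \<gamma>'' r - (\<gamma>'' r \<bullet> \<gamma> r) *\<^sub>R \<gamma> r = 0)"

text \<open>The derivative is taken within the sphere, so only the values of \<open>u\<close> on the
  sphere matter, and it determines the tangent vector \<open>v\<close>.\<close>

definition has_sphere_gradient :: "('a::euclidean_space \<Rightarrow> real) \<Rightarrow> 'a \<Rightarrow> 'a \<Rightarrow> bool" where
  "has_sphere_gradient u v y \<longleftrightarrow>
    v \<bullet> y = 0 \<and> (u has_derivative (\<lambda>h. v \<bullet> h)) (at y within unit_sphere)"

definition sphere_gradient :: "('a::euclidean_space \<Rightarrow> real) \<Rightarrow> 'a \<Rightarrow> 'a" where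
  "sphere_gradient u y = (THE v. has_sphere_gradient u v y)"

text \<open>An embedded hypersurface of the sphere, not necessarily closed: locally a regular level set
  of a \<open>C\<^sup>1\<^sup>,\<^sup>1\<close> function. The function is defined on an open subset of the
  ambient space, with gradient \<open>G\<close> there; the last condition says that the gradient of its
  restriction to the sphere, i.e. the tangential part of \<open>G\<close>, does not vanish.\<close>

definition C11_hypersurface_of_sphere :: "'a::euclidean_space set \<Rightarrow> bool" where
  "C11_hypersurface_of_sphere M \<longleftrightarrow>
    M \<subseteq> unit_sphere \<and>
    (\<forall>p\<in>M. \<exists>W f G L. open W \<and> p \<in> W \<and>
        (\<forall>x\<in>W. GDERIV f x :> G x) \<and> L-lipschitz_on W G \<and>
        M \<inter> W = {x \<in> unit_sphere \<inter> W. f x = 0} \<and>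
        (\<forall>x\<in>M \<inter> W. G x - (G x \<bullet> x) *\<^sub>R x \<noteq> 0))"

section \<open>The sets \<open>\<Gamma>\<^sub>s\<^sup>t\<close>\<close>

definition sphere_boundary :: "'a::euclidean_space set \<Rightarrow> 'a set" where
  "sphere_boundary \<Omega> = top_of_set unit_sphere frontier_of \<Omega>"

definition boundary_dist :: "'a::euclidean_space set \<Rightarrow> 'a \<Rightarrow> real" where
  "boundary_dist \<Omega> y = sphere_infdist y (sphere_boundary \<Omega>)"

definition Gamma_set :: "'a::euclidean_space set \<Rightarrow> real \<Rightarrow> real \<Rightarrow> 'a set" where
  "Gamma_set \<Omega> s t =
    {y \<in> \<Omega>. boundary_dist \<Omega> y = s \<and>
      (\<exists>\<gamma>. unit_speed_geodesic_on {s - t..s} \<gamma> \<and> \<gamma> 0 = y \<and>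
           (\<forall>r\<in>{s - t..s}. boundary_dist \<Omega> (\<gamma> r) = s - r))}"

end

theory Submission
  imports Defs
begin

text \<open>
  The set \<open>\<Gamma>\<^sub>s\<^sup>t\<close> is itself compact, the gradient \<open>N\<close> of the distance \<open>u\<close> to the boundary
  is Lipschitz on it, and all of it lies in one \<open>C\<^sup>1\<^sup>,\<^sup>1\<close> hypersurface of the sphere. So
  one may take every \<open>U\<^sub>j\<close> to be \<open>\<Gamma>\<^sub>s\<^sup>t\<close>, and the set that has to be null is empty.

  Let \<open>y\<close> be in \<open>\<Gamma>\<^sub>s\<^sup>t\<close>. The geodesic through \<open>y\<close> joins a boundary point
  \<open>p = cos s y - sin s N(y)\<close>, at distance \<open>s\<close> from \<open>y\<close>, to a point
  \<open>q = cos (t - s) y + sin (t - s) N(y)\<close>, at distance \<open>t - s\<close> from \<open>y\<close>, with \<open>u(q) = t\<close>. Hence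
  \<open>t - dist(x,q) \<le> u(x) \<le> dist(x,p)\<close> on the whole sphere, with equality at \<open>y\<close>. Both bounds are
  smooth near \<open>y\<close> with the same gradient \<open>N(y)\<close>, which is therefore the gradient of \<open>u\<close>. The
  existence of such \<open>p\<close> and \<open>q\<close> characterises \<open>\<Gamma>\<^sub>s\<^sup>t\<close> and is a closed condition on the
  pair \<open>(y, N(y))\<close>, whence compactness (\<open>unit_normals_of_geodesic\<close>,
  \<open>sphere_infdist_along_normal\<close>, \<open>compact_Gamma_set\<close>).

  For a second point \<open>z\<close> with data \<open>N(z), p', q'\<close>, the inequalities \<open>dist(z,p) \<ge> s\<close> and
  \<open>dist(z,q) \<ge> t - s\<close> are, after taking cosines, the two halves of
  \<open>\<bar>N(y) \<bullet> (z - y)\<bar> \<le> C \<bar>z - y\<bar>\<^sup>2\<close>. The inequality \<open>dist(p,q') \<ge> t\<close> then bounds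
  \<open>1 - N(y) \<bullet> N(z) = \<bar>N(y) - N(z)\<bar>\<^sup>2 / 2\<close> by a multiple of \<open>\<bar>z - y\<bar>\<^sup>2\<close>, so \<open>N\<close> is Lipschitz
  (\<open>unit_normals_estimates\<close>). The constants are uniform since \<open>s\<close> and \<open>t - s\<close> are in \<open>(0, \<pi>)\<close>.

  These two estimates say that the one-jet with value \<open>0\<close> and gradient \<open>N\<close> on \<open>\<Gamma>\<^sub>s\<^sup>t\<close>
  satisfies the hypotheses of Whitney's extension theorem of class \<open>C\<^sup>1\<^sup>,\<^sup>1\<close>
  (\<open>whitney_extension_C11\<close>). The zero set of the extension, restricted to the region where its
  tangential gradient does not vanish, is the hypersurface (\<open>subset_C11_hypersurface_of_sphere\<close>).
  The extension is built from the convex envelope of a family of paraboloids: a convex function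
  that is also semiconcave has a Lipschitz gradient.
\<close>

section \<open>Angles and geodesic distance on the sphere\<close>

definition sphere_angle :: "'a::real_inner \<Rightarrow> 'a \<Rightarrow> real" where
  "sphere_angle x y = arccos (x \<bullet> y)"

lemma abs_inner_unit_le_1:
  assumes "norm x = 1" "norm y = 1"
  shows "\<bar>x \<bullet> y\<bar> \<le> 1"
  using Cauchy_Schwarz_ineq2[of x y] assms by simp

lemma cos_sphere_angle:
  assumes "norm x = 1" "norm y = 1"
  shows "cos (sphere_angle x y) = x \<bullet> y"
  using abs_inner_unit_le_1[OF assms] by (simp add: sphere_angle_def cos_arccos_abs)

lemma sphere_angle_bounds:
  assumes "norm x = 1" "norm y = 1"
  shows "0 \<le> sphere_angle x y" "sphere_angle x y \<le> pi"
  using abs_inner_unit_le_1[OF assms]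
  by (auto simp: sphere_angle_def abs_le_iff intro: arccos_lbound arccos_ubound)

lemma sphere_angle_commute: "sphere_angle x y = sphere_angle y x"
  by (simp add: sphere_angle_def inner_commute)

lemma sphere_angle_self: "norm x = 1 \<Longrightarrow> sphere_angle x x = 0"
  by (simp add: sphere_angle_def dot_square_norm)

lemma le_sphere_angle_iff:
  assumes "norm x = 1" "norm y = 1" "0 \<le> r" "r \<le> pi"
  shows "r \<le> sphere_angle x y \<longleftrightarrow> x \<bullet> y \<le> cos r"
  using cos_mono_le_eq[of "sphere_angle x y" r] assms sphere_angle_bounds[OF assms(1,2)]
  by (simp add: cos_sphere_angle)

lemma norm_diff_unit_squared:
  fixes x y :: "'a::real_inner"
  assumes "norm x = 1" "norm y = 1"
  shows "(norm (x - y))\<^sup>2 = 2 * (1 - x \<bullet> y)"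
  using assms by (simp add: power2_norm_eq_inner inner_diff inner_commute norm_eq_1)

lemma sphere_angle_eq_0D:
  assumes "norm x = 1" "norm y = 1" "sphere_angle x y = 0"
  shows "x = y"
  using norm_diff_unit_squared[OF assms(1,2)] cos_sphere_angle[OF assms(1,2)] assms(3) by simp

text \<open>Split \<open>x\<close> and \<open>z\<close> into their components along \<open>y\<close>, of lengths \<open>cos a\<close> and \<open>cos b\<close>, and orthogonal
  to \<open>y\<close>, of norms \<open>sin a\<close> and \<open>sin b\<close>. The Cauchy-Schwarz inequality for the orthogonal components
  gives \<open>x \<bullet> z \<ge> cos (a + b)\<close>.\<close>

lemma sphere_angle_triangle:
  fixes x y z :: "'a::real_inner"
  assumes x: "norm x = 1" and y: "norm y = 1" and z: "norm z = 1"
  shows "sphere_angle x z \<le> sphere_angle x y + sphere_angle y z"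
proof (cases "sphere_angle x y + sphere_angle y z \<le> pi")
  case True
  define a b where "a = sphere_angle x y" and "b = sphere_angle y z"
  have ab: "0 \<le> a" "a \<le> pi" "0 \<le> b" "b \<le> pi" and cos: "cos a = x \<bullet> y" "cos b = y \<bullet> z"
    using sphere_angle_bounds assms by (auto simp: a_def b_def cos_sphere_angle)
  have sin: "norm (x - cos a *\<^sub>R y) = sin a" "norm (z - cos b *\<^sub>R y) = sin b"
  proof -
    have "(norm (x - cos a *\<^sub>R y))\<^sup>2 = (sin a)\<^sup>2" "(norm (z - cos b *\<^sub>R y))\<^sup>2 = (sin b)\<^sup>2"
      using x y z unfolding power2_norm_eq_inner norm_eq_1
      by (simp_all add: inner_diff inner_commute cos sin_squared_eq)
        (simp_all add: power2_eq_square)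
    then show "norm (x - cos a *\<^sub>R y) = sin a" "norm (z - cos b *\<^sub>R y) = sin b"
      using ab by (simp_all add: power2_eq_iff_nonneg sin_ge_zero)
  qed
  have "- (sin a * sin b) \<le> (x - cos a *\<^sub>R y) \<bullet> (z - cos b *\<^sub>R y)"
    using Cauchy_Schwarz_ineq2[of "x - cos a *\<^sub>R y" "z - cos b *\<^sub>R y"] by (simp add: sin)
  also have "\<dots> = x \<bullet> z - cos a * cos b"
    using y by (simp add: inner_diff inner_commute cos norm_eq_1)
  finally have "cos (a + b) \<le> cos (sphere_angle x z)"
    by (simp add: cos_add cos_sphere_angle x z)
  then show ?thesis
    using cos_mono_le_eq[of "a + b" "sphere_angle x z"] True ab sphere_angle_bounds[OF x z]
    by (simp add: a_def b_def)
next
  case False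
  then show ?thesis using sphere_angle_bounds[OF x z] by simp
qed

lemma sphere_angle_eq_arcsin:
  assumes "norm x = 1" "norm y = 1"
  shows "sphere_angle x y = 2 * arcsin (norm (x - y) / 2)"
proof -
  define \<theta> where "\<theta> = sphere_angle x y"
  have \<theta>: "0 \<le> \<theta>" "\<theta> \<le> pi" "cos \<theta> = x \<bullet> y"
    using sphere_angle_bounds assms by (auto simp: \<theta>_def cos_sphere_angle)
  have "(norm (x - y) / 2)\<^sup>2 = (sin (\<theta> / 2))\<^sup>2"
    using norm_diff_unit_squared[OF assms] cos_double_sin[of "\<theta> / 2"] \<theta>(3)
    by (simp add: power_divide)
  then have "norm (x - y) / 2 = sin (\<theta> / 2)"
    using \<theta> by (simp add: power2_eq_iff_nonneg sin_ge_zero)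
  then show ?thesis
    using \<theta> arcsin_sin[of "\<theta> / 2"] by (simp add: \<theta>_def)
qed

text \<open>Infinitesimally, arc and chord agree: the angle is \<open>2 arcsin (c / 2)\<close> for the chord length \<open>c\<close>, and
  \<open>arcsin\<close> has derivative \<open>1\<close> at \<open>0\<close>.\<close>

lemma sphere_angle_le_chord:
  assumes "e > 0"
  obtains d where "d > 0"
    "\<And>x y :: 'a::real_inner. \<lbrakk>norm x = 1; norm y = 1; norm (x - y) < d\<rbrakk>
       \<Longrightarrow> sphere_angle x y \<le> (1 + e) * norm (x - y)"
proof -
  have "((\<lambda>z. (arcsin z - arcsin 0) / (z - 0)) \<longlongrightarrow> 1) (at (0::real))"
    using DERIV_arcsin[of 0] by (simp add: has_field_derivative_iff)
  then have "\<forall>\<^sub>F z in at (0::real). arcsin z / z < 1 + e"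
    using assms by (intro order_tendstoD(2)[where y = 1]) simp_all
  then obtain d where d: "d > 0" "\<And>z::real. z \<noteq> 0 \<Longrightarrow> \<bar>z\<bar> < d \<Longrightarrow> arcsin z / z < 1 + e"
    by (auto simp: eventually_at dist_norm)
  show thesis
  proof (rule that[of d])
    fix x y :: 'a
    assume xy: "norm x = 1" "norm y = 1" "norm (x - y) < d"
    show "sphere_angle x y \<le> (1 + e) * norm (x - y)"
    proof (cases "x = y")
      case False
      then have "arcsin (norm (x - y) / 2) \<le> (1 + e) * (norm (x - y) / 2)"
        using d(2)[of "norm (x - y) / 2"] xy(3) d(1) by (simp add: field_simps)
      then show ?thesis by (simp add: sphere_angle_eq_arcsin xy)
    qed (use xy in \<open>simp add: sphere_angle_self\<close>)
  qed (use d in simp)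
qed

text \<open>Bounds on chords add up to a bound on the angle: on short subintervals arc and chord agree up to a
  factor \<open>1 + e\<close>, and the triangle inequality glues subintervals together. This serves both
  for curves with finite length and for unit speed geodesics.\<close>

lemma sphere_angle_le_of_chords:
  fixes g :: "real \<Rightarrow> 'a::real_inner"
  assumes "a \<le> b" and cont: "continuous_on {a..b} g"
    and unit: "\<And>r. r \<in> {a..b} \<Longrightarrow> norm (g r) = 1"
    and chord: "\<And>c d. \<lbrakk>a \<le> c; c \<le> d; d \<le> b\<rbrakk> \<Longrightarrow> norm (g c - g d) \<le> len d - len c"
  shows "sphere_angle (g a) (g b) \<le> len b - len a"
proof -
  have len: "0 \<le> len b - len a"
    using chord[of a b] \<open>a \<le> b\<close> norm_ge_zero[of "g a - g b"] by linarith
  have approx: "sphere_angle (g a) (g b) \<le> (1 + e) * (len b - len a)" if e: "e > 0" for e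
  proof -
    obtain \<eta> where \<eta>: "\<eta> > 0" "\<And>x y :: 'a. \<lbrakk>norm x = 1; norm y = 1; norm (x - y) < \<eta>\<rbrakk>
        \<Longrightarrow> sphere_angle x y \<le> (1 + e) * norm (x - y)"
      using sphere_angle_le_chord[OF e] by metis
    obtain d where d: "d > 0"
      "\<And>x y. \<lbrakk>x \<in> {a..b}; y \<in> {a..b}; dist x y < d\<rbrakk> \<Longrightarrow> dist (g x) (g y) < \<eta>"
      using compact_uniformly_continuous[OF cont] \<eta>(1)
      unfolding uniformly_continuous_on_def by (meson compact_Icc dist_commute)
    \<comment> \<open>the guards confine the interval induction to \<open>{a..b}\<close>\<close>
    define P where "P c c' \<longleftrightarrow> (a \<le> c \<longrightarrow> c' \<le> b \<longrightarrow>
        sphere_angle (g c) (g c') \<le> (1 + e) * (len c' - len c))" for c c'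
    have "P a b"
    proof (rule Bolzano[OF \<open>a \<le> b\<close>])
      fix c1 c2 c3
      assume P: "P c1 c2" "P c2 c3" and le: "c1 \<le> c2" "c2 \<le> c3"
      show "P c1 c3"
        unfolding P_def
      proof (intro impI)
        assume "a \<le> c1" "c3 \<le> b"
        then have "sphere_angle (g c1) (g c3)
            \<le> (1 + e) * (len c2 - len c1) + (1 + e) * (len c3 - len c2)"
          using P le sphere_angle_triangle[of "g c1" "g c2" "g c3"] unit
          unfolding P_def by fastforce
        then show "sphere_angle (g c1) (g c3) \<le> (1 + e) * (len c3 - len c1)"
          by (simp add: algebra_simps)
      qed
    next
      fix x
      assume "a \<le> x" "x \<le> b"
      have "P c c'" if "c \<le> x" "x \<le> c'" "c' - c < d" for c c'
        unfolding P_def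
      proof (intro impI)
        assume "a \<le> c" "c' \<le> b"
        then have "norm (g c - g c') < \<eta>" "norm (g c) = 1" "norm (g c') = 1"
          using d(2)[of c c'] unit that by (auto simp: dist_norm)
        then have "sphere_angle (g c) (g c') \<le> (1 + e) * norm (g c - g c')"
          using \<eta>(2) by blast
        also have "\<dots> \<le> (1 + e) * (len c' - len c)"
          using chord[of c c'] \<open>a \<le> c\<close> \<open>c' \<le> b\<close> that \<open>e > 0\<close> by (intro mult_left_mono) auto
        finally show "sphere_angle (g c) (g c') \<le> (1 + e) * (len c' - len c)" .
      qed
      then show "\<exists>d>0. \<forall>c c'. c \<le> x \<and> x \<le> c' \<and> c' - c < d \<longrightarrow> P c c'"
        using d(1) by blast
    qed
    then show ?thesis using \<open>a \<le> b\<close> by (simp add: P_def)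
  qed
  show ?thesis
  proof (rule field_le_epsilon)
    fix e :: real
    assume "e > 0"
    define e' where "e' = e / (1 + (len b - len a))"
    have "e' > 0" using \<open>e > 0\<close> len by (simp add: e'_def)
    have "e' * (len b - len a) \<le> e"
      using \<open>e > 0\<close> len by (simp add: e'_def field_simps)
    then show "sphere_angle (g a) (g b) \<le> len b - len a + e"
      using approx[OF \<open>e' > 0\<close>] by (simp add: algebra_simps)
  qed
qed

text \<open>Used for orthonormal \<open>y\<close> and \<open>v\<close>, when it is the unit speed geodesic from \<open>y\<close> in direction \<open>v\<close>.\<close>

definition great_circle :: "'a::real_vector \<Rightarrow> 'a \<Rightarrow> real \<Rightarrow> 'a" where
  "great_circle y v r = cos r *\<^sub>R y + sin r *\<^sub>R v"

lemma great_circle_0 [simp]: "great_circle y v 0 = y"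
  by (simp add: great_circle_def)

lemma great_circle_reverse: "great_circle y (- v) r = great_circle y v (- r)"
  by (simp add: great_circle_def)

lemma inner_great_circle:
  assumes "norm y = 1" "norm v = 1" "y \<bullet> v = 0"
  shows "great_circle y v a \<bullet> great_circle y v b = cos (a - b)"
  using assms by (simp add: great_circle_def inner_add inner_commute cos_diff norm_eq_1)

lemma norm_great_circle:
  assumes "norm y = 1" "norm v = 1" "y \<bullet> v = 0"
  shows "norm (great_circle y v a) = 1"
  using inner_great_circle[OF assms, of a a] by (simp add: norm_eq_1)

lemma sphere_angle_great_circle:
  assumes "norm y = 1" "norm v = 1" "y \<bullet> v = 0" "\<bar>a - b\<bar> \<le> pi"
  shows "sphere_angle (great_circle y v a) (great_circle y v b) = \<bar>a - b\<bar>"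
  using assms(4) by (simp add: sphere_angle_def inner_great_circle[OF assms(1-3)] arccos_cos_eq_abs)

lemma has_vector_derivative_great_circle:
  fixes y v :: "'a::real_normed_vector"
  shows "(great_circle y v has_vector_derivative great_circle v (- y) r) (at r within A)"
  unfolding great_circle_def
  by (auto intro!: derivative_eq_intros simp: has_vector_derivative_def scaleR_diff_right algebra_simps)

text \<open>The dimension bound is needed for \<open>y = \<plusminus>x\<close>, when any unit vector orthogonal to \<open>x\<close> can serve as
  the direction.\<close>

lemma ex_great_circle_through:
  fixes x y :: "'a::euclidean_space"
  assumes dim: "2 \<le> DIM('a)" and x: "norm x = 1" and y: "norm y = 1"
  obtains v where "norm v = 1" "x \<bullet> v = 0" "y = great_circle x v (sphere_angle x y)"
proof -
  define \<theta> where "\<theta> = sphere_angle x y"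
  have \<theta>: "0 \<le> \<theta>" "\<theta> \<le> pi" "cos \<theta> = x \<bullet> y"
    using sphere_angle_bounds x y by (auto simp: \<theta>_def cos_sphere_angle)
  define w where "w = y - cos \<theta> *\<^sub>R x"
  have xw: "x \<bullet> w = 0"
    using x by (simp add: w_def inner_diff_right \<theta>(3) norm_eq_1)
  have "(norm w)\<^sup>2 = (sin \<theta>)\<^sup>2"
    using x y unfolding power2_norm_eq_inner norm_eq_1
    by (simp add: w_def inner_diff inner_commute \<theta>(3) sin_squared_eq)
       (simp add: power2_eq_square)
  then have nw: "norm w = sin \<theta>"
    using \<theta> by (simp add: power2_eq_iff_nonneg sin_ge_zero)
  show thesis
  proof (cases "w = 0")
    case True
    obtain b where b: "b \<noteq> 0" "orthogonal x b"
      using orthogonal_to_vector_exists[OF dim] by blast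
    have "norm (b /\<^sub>R norm b) = 1" "x \<bullet> (b /\<^sub>R norm b) = 0"
      using b by (simp_all add: orthogonal_def)
    moreover have "y = great_circle x (b /\<^sub>R norm b) (sphere_angle x y)"
      using True nw by (simp add: w_def great_circle_def \<theta>_def)
    ultimately show thesis using that by blast
  next
    case False
    have "norm (w /\<^sub>R norm w) = 1" "x \<bullet> (w /\<^sub>R norm w) = 0"
      using False xw by simp_all
    moreover have "y = great_circle x (w /\<^sub>R norm w) (sphere_angle x y)"
      using False nw by (simp add: great_circle_def \<theta>_def[symmetric] flip: nw) (simp add: w_def)
    ultimately show thesis using that by blast
  qed
qed

lemma sphere_angle_le_length:
  assumes g: "valid_path g" "path_image g \<subseteq> unit_sphere"
    and len: "((\<lambda>t. norm (vector_derivative g (at t))) has_integral L) {0..1}"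
  shows "sphere_angle (pathstart g) (pathfinish g) \<le> L"
proof -
  define v where "v = (\<lambda>t. vector_derivative g (at t))"
  obtain S where S: "finite S" "continuous_on {0..1} g" "g C1_differentiable_on {0..1} - S"
    using g(1) by (auto simp: valid_path_def piecewise_C1_differentiable_on_def)
  have deriv: "(g has_vector_derivative v r) (at r)" if "r \<in> {0..1} - S" for r
    using S(3) that unfolding v_def C1_differentiable_on_eq by (simp add: vector_derivative_works)
  define len where "len c = integral {0..c} (\<lambda>t. norm (v t))" for c
  have int: "(\<lambda>t. norm (v t)) integrable_on {c..d}" if "0 \<le> c" "d \<le> 1" for c d
    using len that unfolding v_def
    by (meson has_integral_integrable integrable_subinterval_real atLeastatMost_subset_iff)
  have "sphere_angle (g 0) (g 1) \<le> len 1 - len 0"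
  proof (rule sphere_angle_le_of_chords)
    fix c d :: real
    assume cd: "0 \<le> c" "c \<le> d" "d \<le> 1"
    have "(v has_integral (g d - g c)) {c..d}"
    proof (rule fundamental_theorem_of_calculus_strong[OF S(1) cd(2)])
      show "continuous_on {c..d} g" using S(2) cd by (auto elim: continuous_on_subset)
      show "(g has_vector_derivative v r) (at r)" if "r \<in> {c..d} - S" for r
        using that cd by (intro deriv) auto
    qed
    then have "norm (g d - g c) \<le> integral {c..d} (\<lambda>t. norm (v t))"
      using integral_norm_bound_integral[of v "{c..d}" "\<lambda>t. norm (v t)"] int cd
      by (auto simp: has_integral_iff)
    also have "\<dots> = len d - len c"
      using Henstock_Kurzweil_Integration.integral_combine[of 0 c d "\<lambda>t. norm (v t)"] int[of 0 d] cd
      by (simp add: len_def)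
    finally show "norm (g c - g d) \<le> len d - len c" by (simp add: norm_minus_commute)
  qed (use S(2) g(2) in \<open>auto simp: path_image_def image_subset_iff\<close>)
  then show ?thesis
    using len by (simp add: pathstart_def pathfinish_def len_def v_def has_integral_iff)
qed

text \<open>The great circle arc has length equal to the angle, and \<open>sphere_angle_le_length\<close> shows that no
  curve is shorter.\<close>

theorem sphere_dist_eq_angle:
  fixes x y :: "'a::euclidean_space"
  assumes dim: "2 \<le> DIM('a)" and x: "norm x = 1" and y: "norm y = 1"
  shows "sphere_dist x y = sphere_angle x y"
  unfolding sphere_dist_def
proof (rule cInf_eq_minimum)
  define \<theta> where "\<theta> = sphere_angle x y"
  obtain v where v: "norm v = 1" "x \<bullet> v = 0" "y = great_circle x v \<theta>"
    using ex_great_circle_through[OF assms] unfolding \<theta>_def by blast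
  define g where "g = (\<lambda>r. great_circle x v (\<theta> * r))"
  have deriv: "(g has_vector_derivative \<theta> *\<^sub>R great_circle v (- x) (\<theta> * r)) (at r)" for r
  proof -
    have "((\<lambda>r. \<theta> * r) has_vector_derivative \<theta>) (at r)"
      by (auto intro!: derivative_eq_intros)
    from vector_diff_chain_at[OF this has_vector_derivative_great_circle]
    show ?thesis by (simp add: g_def o_def)
  qed
  have "continuous_on {0..1} (\<lambda>r. \<theta> *\<^sub>R great_circle v (- x) (\<theta> * r))"
    unfolding great_circle_def by (intro continuous_intros)
  then have "g C1_differentiable_on {0..1}"
    using deriv unfolding C1_differentiable_on_def
    by (intro exI[of _ "\<lambda>r. \<theta> *\<^sub>R great_circle v (- x) (\<theta> * r)"]) simp
  then have "valid_path g"
    by (simp add: valid_path_def C1_differentiable_imp_piecewise)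
  moreover have "path_image g \<subseteq> unit_sphere"
    using norm_great_circle[OF x v(1,2)] by (auto simp: path_image_def g_def)
  moreover have "pathstart g = x" "pathfinish g = y"
    using v(3) by (simp_all add: pathstart_def pathfinish_def g_def)
  moreover have "((\<lambda>t. norm (vector_derivative g (at t))) has_integral \<theta>) {0..1}"
  proof -
    have "norm (vector_derivative g (at r)) = \<theta>" for r
      using vector_derivative_at[OF deriv, of r] norm_great_circle[of v "- x" "\<theta> * r"] x v(1,2)
        sphere_angle_bounds[OF x y] by (simp add: inner_commute \<theta>_def)
    then show ?thesis using has_integral_const_real[of \<theta> 0 1] by simp
  qed
  ultimately show "sphere_angle x y \<in> {L. \<exists>g. valid_path g \<and> path_image g \<subseteq> unit_sphere \<and>
      pathstart g = x \<and> pathfinish g = y \<and>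
      ((\<lambda>t. norm (vector_derivative g (at t))) has_integral L) {0..1}}"
    unfolding \<theta>_def[symmetric] by blast
next
  fix L
  assume "L \<in> {L. \<exists>g. valid_path g \<and> path_image g \<subseteq> unit_sphere \<and>
      pathstart g = x \<and> pathfinish g = y \<and>
      ((\<lambda>t. norm (vector_derivative g (at t))) has_integral L) {0..1}}"
  then show "sphere_angle x y \<le> L"
    using sphere_angle_le_length by blast
qed

section \<open>Distance to a compact subset of the sphere\<close>

context
  fixes K :: "'a::euclidean_space set"
  assumes dim: "2 \<le> DIM('a)" and K: "compact K" "K \<noteq> {}" "K \<subseteq> unit_sphere"
begin

lemma sphere_infdist_eq_angle:
  assumes "norm x = 1"
  shows "sphere_infdist x K = (INF a\<in>K. sphere_angle x a)"
  unfolding sphere_infdist_def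
  using K(3) sphere_dist_eq_angle[OF dim assms] by (intro INF_cong) auto

lemma sphere_infdist_le_angle:
  assumes "norm x = 1" "a \<in> K"
  shows "sphere_infdist x K \<le> sphere_angle x a"
  unfolding sphere_infdist_eq_angle[OF assms(1)]
proof (rule cINF_lower)
  show "bdd_below (sphere_angle x ` K)"
    using sphere_angle_bounds(1)[OF assms(1)] K(3) by (intro bdd_belowI[of _ 0]) auto
qed (rule assms(2))

lemma sphere_infdist_attained:
  assumes x: "norm x = 1"
  obtains a where "a \<in> K" "sphere_infdist x K = sphere_angle x a"
proof -
  have "continuous_on K (\<lambda>a. sphere_angle x a)"
    unfolding sphere_angle_def
  proof (intro continuous_intros ballI conjI)
    fix a
    assume "a \<in> K"
    then show "- 1 \<le> x \<bullet> a" "x \<bullet> a \<le> 1"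
      using abs_inner_unit_le_1[OF x, of a] K(3) by (auto simp: abs_le_iff)
  qed
  then obtain a where a: "a \<in> K" "\<And>b. b \<in> K \<Longrightarrow> sphere_angle x a \<le> sphere_angle x b"
    using continuous_attains_inf[OF K(1,2)] by blast
  then have "sphere_angle x a \<le> sphere_infdist x K"
    unfolding sphere_infdist_eq_angle[OF x] using K(2) by (intro cINF_greatest)
  then show thesis
    using that[OF a(1)] sphere_infdist_le_angle[OF x a(1)] by simp
qed

lemma sphere_infdist_triangle:
  assumes "norm x = 1" "norm y = 1"
  shows "sphere_infdist x K \<le> sphere_angle x y + sphere_infdist y K"
proof -
  obtain a where a: "a \<in> K" "sphere_infdist y K = sphere_angle y a"
    using sphere_infdist_attained[OF assms(2)] by blast
  then show ?thesis
    using sphere_infdist_le_angle[OF assms(1) a(1)] sphere_angle_triangle[OF assms, of a] K(3)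
    by auto
qed

end

text \<open>A pair \<open>(y, v)\<close> for which \<open>v\<close> is a unit tangent vector at \<open>y\<close>, the geodesic in direction \<open>- v\<close>
  reaches \<open>K\<close> at time \<open>s\<close>, and the point reached at time \<open>t - s\<close> in direction \<open>v\<close> has distance at
  least \<open>t\<close> from \<open>K\<close>. The last condition is written with inner products, so that all conditions
  are visibly closed.\<close>

definition unit_normals :: "'a::euclidean_space set \<Rightarrow> real \<Rightarrow> real \<Rightarrow> ('a \<times> 'a) set" where
  "unit_normals K s t = {(y, v). norm y = 1 \<and> norm v = 1 \<and> y \<bullet> v = 0 \<and>
      great_circle y v (- s) \<in> K \<and> (\<forall>a\<in>K. great_circle y v (t - s) \<bullet> a \<le> cos t)}"

lemma compact_unit_normals:
  assumes "compact K"
  shows "compact (unit_normals K s t)"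
proof -
  have eq: "unit_normals K s t = (unit_sphere \<times> unit_sphere) \<inter> ({p. fst p \<bullet> snd p = 0}
      \<inter> ((\<lambda>p. great_circle (fst p) (snd p) (- s)) -` K
      \<inter> (\<Inter>a\<in>K. {p. great_circle (fst p) (snd p) (t - s) \<bullet> a \<le> cos t})))"
    by (auto simp: unit_normals_def)
  have "closed {p :: 'a \<times> 'a. fst p \<bullet> snd p = 0}"
    by (intro closed_Collect_eq continuous_intros)
  moreover have "closed ((\<lambda>p. great_circle (fst p) (snd p) (- s)) -` K)"
    unfolding great_circle_def
    by (intro closed_vimage compact_imp_closed assms continuous_intros)
  moreover have "closed (\<Inter>a\<in>K. {p. great_circle (fst p) (snd p) (t - s) \<bullet> a \<le> cos t})"
    unfolding great_circle_def
    by (intro closed_INT ballI closed_Collect_le continuous_intros)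
  ultimately show ?thesis
    unfolding eq by (intro compact_Int_closed[OF compact_Times] compact_sphere closed_Int)
qed

section \<open>Gradients on the sphere\<close>

lemma has_derivative_squeeze_within:
  fixes f lo up :: "'a::real_normed_vector \<Rightarrow> real"
  assumes lo: "(lo has_derivative D) (at y within S)" and up: "(up has_derivative D) (at y within S)"
    and le: "\<And>x. x \<in> S \<Longrightarrow> lo x \<le> f x" "\<And>x. x \<in> S \<Longrightarrow> f x \<le> up x"
    and eq: "lo y = f y" "up y = f y"
  shows "(f has_derivative D) (at y within S)"
  unfolding has_derivative_within
proof (intro conjI)
  show "bounded_linear D" using lo by (rule has_derivative_bounded_linear)
  define q where "q F z = (1 / norm (z - y)) *\<^sub>R (F z - (F y + D (z - y)))" for F and z
  have lim: "(q lo \<longlongrightarrow> 0) (at y within S)" "(q up \<longlongrightarrow> 0) (at y within S)"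
    using lo up unfolding has_derivative_within q_def by blast+
  have "q lo z \<le> q f z" "q f z \<le> q up z" if "z \<in> S" for z
    using le[OF that] eq by (auto simp: q_def intro!: mult_left_mono divide_right_mono)
  then have "(q f \<longlongrightarrow> 0) (at y within S)"
    by (intro real_tendsto_sandwich[OF _ _ lim]) (auto simp: eventually_at_filter)
  then show "((\<lambda>z. (1 / norm (z - y)) *\<^sub>R (f z - (f y + D (z - y)))) \<longlongrightarrow> 0) (at y within S)"
    unfolding q_def .
qed

text \<open>On the sphere \<open>x \<bullet> y = 1 - \<bar>x - y\<bar>\<^sup>2 / 2\<close> is stationary at \<open>y\<close>, so only the component of
  the target along \<open>v\<close> contributes to the derivative of the distance to it.\<close>

lemma sphere_angle_has_derivative:
  fixes y v :: "'a::euclidean_space"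
  assumes yv: "norm y = 1" "norm v = 1" "y \<bullet> v = 0" and r: "0 < r" "r < pi"
  shows "((\<lambda>x. sphere_angle x (great_circle y v (- r))) has_derivative (\<lambda>h. v \<bullet> h))
    (at y within unit_sphere)"
proof -
  have sin: "sin r > 0" using r by (rule sin_gt_zero)
  have flat: "((\<lambda>x. x \<bullet> y) has_derivative (\<lambda>h. 0)) (at y within unit_sphere)"
  proof (rule has_derivative_transform)
    show "((\<lambda>x. 1 - ((x - y) \<bullet> (x - y)) / 2) has_derivative (\<lambda>h. 0)) (at y within unit_sphere)"
      by (auto intro!: derivative_eq_intros)
    show "x \<bullet> y = 1 - ((x - y) \<bullet> (x - y)) / 2" if "x \<in> unit_sphere" for x
      using that norm_diff_unit_squared[of x y] yv(1) by (simp add: power2_norm_eq_inner diff_divide_distrib)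
  qed (use yv in simp)
  have "((\<lambda>x. x \<bullet> great_circle y v (- r)) has_derivative (\<lambda>h. - sin r * (v \<bullet> h)))
      (at y within unit_sphere)"
  proof -
    have eq: "x \<bullet> great_circle y v (- r) = cos r * (x \<bullet> y) - sin r * (x \<bullet> v)" for x
      by (simp add: great_circle_def inner_diff_right)
    have "((\<lambda>x. cos r * (x \<bullet> y) - sin r * (x \<bullet> v)) has_derivative
        (\<lambda>h. cos r * 0 - sin r * (h \<bullet> v))) (at y within unit_sphere)"
      by (intro has_derivative_diff has_derivative_mult_right flat has_derivative_inner_left
          has_derivative_ident)
    then show ?thesis by (simp add: eq inner_commute)
  qed
  moreover have cos: "y \<bullet> great_circle y v (- r) = cos r"
    using inner_great_circle[OF yv, of 0 "- r"] by simp
  have "DERIV arccos (y \<bullet> great_circle y v (- r)) :> - inverse (sin r)"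
  proof -
    have "- 1 < cos r" "cos r < 1"
      using cos_monotone_0_pi[of r pi] cos_monotone_0_pi[of 0 r] r by simp_all
    moreover have "sqrt (1 - (cos r)\<^sup>2) = sin r"
      using sin by (simp flip: sin_squared_eq)
    ultimately show ?thesis using DERIV_arccos[of "cos r"] by (simp add: cos)
  qed
  ultimately have "((\<lambda>x. arccos (x \<bullet> great_circle y v (- r))) has_derivative
      (\<lambda>h. (- sin r * (v \<bullet> h)) * - inverse (sin r))) (at y within unit_sphere)"
    by (intro DERIV_compose_FDERIV)
  moreover have "(- sin r * (v \<bullet> h)) * - inverse (sin r) = v \<bullet> h" for h
    using sin by simp
  ultimately show ?thesis by (simp only: sphere_angle_def)
qed

text \<open>Derivatives within the sphere determine a vector only up to its normal component. Two tangential
  candidates are told apart by the great circle in the direction of their difference.\<close>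

lemma has_sphere_gradient_unique:
  fixes y v w :: "'a::euclidean_space"
  assumes y: "norm y = 1" and v: "has_sphere_gradient u v y" and w: "has_sphere_gradient u w y"
  shows "v = w"
proof (rule ccontr)
  assume "v \<noteq> w"
  define e where "e = (v - w) /\<^sub>R norm (v - w)"
  have "y \<bullet> (v - w) = 0"
    using v w by (simp add: has_sphere_gradient_def inner_diff_right inner_commute)
  then have e: "norm e = 1" "y \<bullet> e = 0" "(v - w) \<bullet> e = norm (v - w)"
    using \<open>v \<noteq> w\<close> by (simp_all add: e_def dot_square_norm power2_eq_square)
  have curve: "((\<lambda>r. u (great_circle y e r)) has_derivative (\<lambda>r. x \<bullet> (r *\<^sub>R e))) (at 0)"
    if "has_sphere_gradient u x y" for x
  proof (rule has_derivative_in_compose[where f = "great_circle y e" and g = u])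
    show "(great_circle y e has_derivative (\<lambda>r. r *\<^sub>R e)) (at 0)"
      using has_vector_derivative_great_circle[of y e 0 UNIV] by (simp add: has_vector_derivative_def)
    have "(u has_derivative (\<lambda>h. x \<bullet> h)) (at y within unit_sphere)"
      using that by (simp add: has_sphere_gradient_def)
    then show "(u has_derivative (\<lambda>h. x \<bullet> h)) (at (great_circle y e 0) within range (great_circle y e))"
      using norm_great_circle[OF y e(1,2)] by (auto elim!: has_derivative_subset)
  qed
  have "v \<bullet> e = w \<bullet> e"
    using fun_cong[OF has_derivative_unique[OF curve[OF v] curve[OF w]], of 1] by simp
  then show False using e(3) \<open>v \<noteq> w\<close> by (simp add: inner_diff_left)
qed

lemma sphere_gradient_eqI:
  assumes "norm y = 1" "has_sphere_gradient u v y"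
  shows "sphere_gradient u y = v"
  unfolding sphere_gradient_def
  using assms has_sphere_gradient_unique by (intro the_equality) blast+

section \<open>Points with a normal geodesic on both sides\<close>

lemma geodesic_sphere_angle_le:
  fixes \<gamma> :: "real \<Rightarrow> 'a::euclidean_space"
  assumes \<gamma>: "unit_speed_geodesic_on {a..b} \<gamma>" and cd: "a \<le> c" "c \<le> d" "d \<le> b"
  shows "sphere_angle (\<gamma> c) (\<gamma> d) \<le> d - c"
proof -
  obtain \<gamma>' \<gamma>'' :: "real \<Rightarrow> 'a" where "\<forall>r\<in>{a..b}. \<gamma> r \<in> unit_sphere \<and>
      (\<gamma> has_vector_derivative \<gamma>' r) (at r within {a..b}) \<and>
      (\<gamma>' has_vector_derivative \<gamma>'' r) (at r within {a..b}) \<and> norm (\<gamma>' r) = 1 \<and>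
      \<gamma>'' r - (\<gamma>'' r \<bullet> \<gamma> r) *\<^sub>R \<gamma> r = 0"
    using \<gamma> unfolding unit_speed_geodesic_on_def by blast
  then have \<gamma>': "\<And>r. r \<in> {a..b} \<Longrightarrow> norm (\<gamma> r) = 1"
      "\<And>r. r \<in> {a..b} \<Longrightarrow> (\<gamma> has_vector_derivative \<gamma>' r) (at r within {a..b})"
      "\<And>r. r \<in> {a..b} \<Longrightarrow> norm (\<gamma>' r) = 1"
    by simp_all
  have "continuous_on {a..b} \<gamma>"
    unfolding continuous_on_eq_continuous_within
    using has_vector_derivative_continuous[OF \<gamma>'(2)] by blast
  then have cont: "continuous_on {c..d} \<gamma>"
    using cd by (auto elim: continuous_on_subset)
  have chord: "norm (\<gamma> c' - \<gamma> d') \<le> d' - c'" if "c \<le> c'" "c' \<le> d'" "d' \<le> d" for c' d'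
  proof -
    have "(\<gamma>' has_integral (\<gamma> d' - \<gamma> c')) {c'..d'}"
    proof (rule fundamental_theorem_of_calculus[OF that(2)])
      show "(\<gamma> has_vector_derivative \<gamma>' r) (at r within {c'..d'})" if "r \<in> {c'..d'}" for r
        using \<gamma>'(2)[of r] that cd \<open>c \<le> c'\<close> \<open>d' \<le> d\<close>
        by (auto elim: has_vector_derivative_within_subset)
    qed
    then have "norm (\<gamma> d' - \<gamma> c') \<le> 1 * measure lborel {c'..d'}"
      using \<gamma>'(3) that cd by (intro has_integral_bound_real[where f = \<gamma>' and S = "{}"]) auto
    then show ?thesis using that by (simp add: norm_minus_commute)
  qed
  show ?thesis
    using sphere_angle_le_of_chords[OF cd(2) cont, of "\<lambda>r. r"] chord \<gamma>'(1) cd by auto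
qed

lemma unit_speed_geodesic_great_circle:
  fixes y v :: "'a::euclidean_space"
  assumes "norm y = 1" "norm v = 1" "y \<bullet> v = 0"
  shows "unit_speed_geodesic_on I (great_circle y v)"
proof -
  have "great_circle (- y) (- v) r = - great_circle y v r" for r
    by (simp add: great_circle_def)
  moreover have "norm (great_circle v (- y) r) = 1" for r
    using assms by (intro norm_great_circle) (simp_all add: inner_commute)
  moreover have "norm (great_circle y v r) = 1" for r
    using assms by (rule norm_great_circle)
  ultimately show ?thesis
    unfolding unit_speed_geodesic_on_def
    using has_vector_derivative_great_circle[of y v] has_vector_derivative_great_circle[of v "- y"]
    by (intro exI[of _ "great_circle v (- y)"] exI[of _ "great_circle (- y) (- v)"])
      (simp add: dot_square_norm)
qed

context
  fixes K :: "'a::euclidean_space set" and s t :: real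
  assumes dim: "2 \<le> DIM('a)" and K: "compact K" "K \<noteq> {}" "K \<subseteq> unit_sphere"
    and st: "0 < s" "s < t" "t < pi"
begin

lemmas infdist_le = sphere_infdist_le_angle[OF dim K]
lemmas infdist_triangle = sphere_infdist_triangle[OF dim K]

lemma unit_normals_iff:
  "(y, v) \<in> unit_normals K s t \<longleftrightarrow> norm y = 1 \<and> norm v = 1 \<and> y \<bullet> v = 0 \<and>
    great_circle y v (- s) \<in> K \<and> t \<le> sphere_infdist (great_circle y v (t - s)) K"
proof -
  have "(\<forall>a\<in>K. q \<bullet> a \<le> cos t) \<longleftrightarrow> t \<le> sphere_infdist q K" if q: "norm q = 1" for q
  proof -
    have "q \<bullet> a \<le> cos t \<longleftrightarrow> t \<le> sphere_angle q a" if "a \<in> K" for a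
      using that K(3) le_sphere_angle_iff[OF q, of a t] st by auto
    moreover have "(\<forall>a\<in>K. t \<le> sphere_angle q a) \<longleftrightarrow> t \<le> sphere_infdist q K"
      using sphere_infdist_attained[OF dim K q] infdist_le[OF q] by (metis order_trans)
    ultimately show ?thesis by auto
  qed
  then show ?thesis
    unfolding unit_normals_def using norm_great_circle[of y v "t - s"] by auto
qed

text \<open>The distance to the endpoint in \<open>K\<close> bounds the distance to \<open>K\<close> from above, and the other endpoint,
  at distance at least \<open>t\<close> from \<open>K\<close>, bounds it from below. Both bounds agree as the arc between the
  endpoints has length \<open>t \<le> \<pi>\<close>.\<close>

lemma sphere_infdist_along_normal:
  assumes yv: "(y, v) \<in> unit_normals K s t" and r: "- s \<le> r" "r \<le> t - s"
  shows "sphere_infdist (great_circle y v r) K = s + r"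
proof -
  have y: "norm y = 1" "norm v = 1" "y \<bullet> v = 0" and p: "great_circle y v (- s) \<in> K"
    and q: "t \<le> sphere_infdist (great_circle y v (t - s)) K"
    using yv by (auto simp: unit_normals_iff)
  have "sphere_infdist (great_circle y v r) K \<le> s + r"
    using infdist_le[OF norm_great_circle[OF y] p, of r] sphere_angle_great_circle[OF y, of r "- s"]
      r st by simp
  moreover have "t \<le> (t - s - r) + sphere_infdist (great_circle y v r) K"
    using infdist_triangle[OF norm_great_circle[OF y] norm_great_circle[OF y], of "t - s" r] q
      sphere_angle_great_circle[OF y, of "t - s" r] r st by simp
  ultimately show ?thesis by simp
qed

text \<open>The distance to \<open>K\<close> is squeezed between \<open>t\<close> minus the distance to one end of the normal geodesic
  and the distance to the other end. These two functions touch at \<open>y\<close> with common gradient \<open>v\<close>.\<close>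

lemma unit_normals_has_sphere_gradient:
  assumes yv: "(y, v) \<in> unit_normals K s t"
  shows "has_sphere_gradient (\<lambda>x. sphere_infdist x K) v y"
  unfolding has_sphere_gradient_def
proof
  have y: "norm y = 1" "norm v = 1" "y \<bullet> v = 0" and p: "great_circle y v (- s) \<in> K"
    and q: "t \<le> sphere_infdist (great_circle y v (t - s)) K"
    using yv by (auto simp: unit_normals_iff)
  have q_eq: "great_circle y v (t - s) = great_circle y (- v) (- (t - s))"
    by (simp only: great_circle_reverse minus_minus)
  have dist: "sphere_infdist y K = s"
    using sphere_infdist_along_normal[OF yv, of 0] st by simp
  let ?lo = "\<lambda>x. t - sphere_angle x (great_circle y v (t - s))"
  let ?up = "\<lambda>x. sphere_angle x (great_circle y v (- s))"
  show "v \<bullet> y = 0" using y by (simp add: inner_commute)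
  have up: "(?up has_derivative (\<lambda>h. v \<bullet> h)) (at y within unit_sphere)"
    using st by (intro sphere_angle_has_derivative y) auto
  have "((\<lambda>x. sphere_angle x (great_circle y v (t - s))) has_derivative (\<lambda>h. (- v) \<bullet> h))
      (at y within unit_sphere)"
    unfolding q_eq using st y by (intro sphere_angle_has_derivative) auto
  then have lo: "(?lo has_derivative (\<lambda>h. v \<bullet> h)) (at y within unit_sphere)"
    by (auto intro!: derivative_eq_intros)
  show "((\<lambda>x. sphere_infdist x K) has_derivative (\<lambda>h. v \<bullet> h)) (at y within unit_sphere)"
  proof (rule has_derivative_squeeze_within[OF lo up])
    show "sphere_infdist x K \<le> ?up x" if "x \<in> unit_sphere" for x
      using infdist_le[OF _ p] that by simp
    show "?lo x \<le> sphere_infdist x K" if "x \<in> unit_sphere" for x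
      using infdist_triangle[OF norm_great_circle[OF y], of x "t - s"] that q
      by (simp add: sphere_angle_commute)
    show "?lo y = sphere_infdist y K"
      using sphere_angle_great_circle[OF y, of 0 "t - s"] st dist by simp
    show "?up y = sphere_infdist y K"
      using sphere_angle_great_circle[OF y, of 0 "- s"] st dist by simp
  qed
qed

text \<open>The two endpoints belonging to \<open>(y, v)\<close> cannot be too close to \<open>z\<close>; this makes \<open>z - y\<close> tangential to
  second order. The endpoint in \<open>K\<close> of one pair and the far endpoint of the other have distance at
  least \<open>t\<close>; expanded in \<open>y, v, z, w\<close>, this controls \<open>1 - v \<bullet> w\<close>, hence \<open>\<bar>w - v\<bar>\<^sup>2\<close>.\<close>

lemma unit_normals_estimates:
  obtains C L where "C \<ge> 0" "L \<ge> 0"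
    "\<And>y v z w. \<lbrakk>(y, v) \<in> unit_normals K s t; (z, w) \<in> unit_normals K s t\<rbrakk>
       \<Longrightarrow> \<bar>v \<bullet> z\<bar> \<le> C * (norm (z - y))\<^sup>2"
    "\<And>y v z w. \<lbrakk>(y, v) \<in> unit_normals K s t; (z, w) \<in> unit_normals K s t\<rbrakk>
       \<Longrightarrow> norm (w - v) \<le> L * norm (z - y)"
proof -
  define m where "m = min (sin s) (sin (t - s))"
  have sin: "sin s > 0" "sin (t - s) > 0"
    using st by (auto intro: sin_gt_zero)
  have m: "0 < m" "m \<le> sin s" "m \<le> sin (t - s)"
    using sin by (auto simp: m_def)
  have tangent: "m * \<bar>v \<bullet> z\<bar> \<le> (norm (z - y))\<^sup>2 / 2"
    if yv: "(y, v) \<in> unit_normals K s t" and zw: "(z, w) \<in> unit_normals K s t" for y v z w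
  proof -
    have y: "norm y = 1" "norm v = 1" "y \<bullet> v = 0" and p: "great_circle y v (- s) \<in> K"
      and q: "t \<le> sphere_infdist (great_circle y v (t - s)) K" and z: "norm z = 1"
      using yv zw by (auto simp: unit_normals_iff)
    have dist: "sphere_infdist z K = s"
      using sphere_infdist_along_normal[OF zw, of 0] st by simp
    have D: "(norm (z - y))\<^sup>2 / 2 = 1 - z \<bullet> y"
      using norm_diff_unit_squared[OF z y(1)] by simp
    have small: "c * (1 - z \<bullet> y) \<le> 1 - z \<bullet> y" if "c \<le> 1" for c
      using mult_right_mono[OF that, of "1 - z \<bullet> y"] abs_inner_unit_le_1[OF z y(1)] by simp
    have "s \<le> sphere_angle z (great_circle y v (- s))"
      using infdist_le[OF z p] dist by simp
    then have "z \<bullet> great_circle y v (- s) \<le> cos s"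
      using le_sphere_angle_iff[OF z norm_great_circle[OF y]] st by simp
    then have "sin s * - (v \<bullet> z) \<le> 1 - z \<bullet> y"
      using small[of "cos s"] by (simp add: great_circle_def inner_diff_right inner_commute algebra_simps)
    moreover have "t - s \<le> sphere_angle z (great_circle y v (t - s))"
      using infdist_triangle[OF norm_great_circle[OF y] z, of "t - s"] dist q
      by (simp add: sphere_angle_commute)
    then have "z \<bullet> great_circle y v (t - s) \<le> cos (t - s)"
      using le_sphere_angle_iff[OF z norm_great_circle[OF y]] st by simp
    then have "sin (t - s) * (v \<bullet> z) \<le> 1 - z \<bullet> y"
      using small[of "cos (t - s)"]
      by (simp add: great_circle_def inner_add_right inner_commute algebra_simps)
    moreover have "m * \<bar>v \<bullet> z\<bar> \<le> sin s * \<bar>v \<bullet> z\<bar>" "m * \<bar>v \<bullet> z\<bar> \<le> sin (t - s) * \<bar>v \<bullet> z\<bar>"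
      using m by (intro mult_right_mono; simp)+
    ultimately show ?thesis
      unfolding D abs_real_def by (cases "v \<bullet> z < 0") (simp_all only: if_True if_False)
  qed
  define C where "C = 1 / (2 * m)"
  define L2 where "L2 = (1 + 4 * C) / m\<^sup>2"
  have C: "C \<ge> 0" "L2 \<ge> 0" using m by (simp_all add: C_def L2_def)
  have tangent': "\<bar>v \<bullet> z\<bar> \<le> C * (norm (z - y))\<^sup>2"
    if "(y, v) \<in> unit_normals K s t" "(z, w) \<in> unit_normals K s t" for y v z w
    using tangent[OF that] m(1) by (simp add: C_def field_simps)
  have lip: "norm (w - v) \<le> sqrt L2 * norm (z - y)"
    if yv: "(y, v) \<in> unit_normals K s t" and zw: "(z, w) \<in> unit_normals K s t" for y v z w
  proof -
    define D where "D = (norm (z - y))\<^sup>2"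
    have y: "norm y = 1" "norm v = 1" and z: "norm z = 1" "norm w = 1"
      using yv zw by (auto simp: unit_normals_iff)
    have D: "1 - y \<bullet> z = D / 2" "1 - v \<bullet> w = (norm (w - v))\<^sup>2 / 2"
      using norm_diff_unit_squared[of z y] norm_diff_unit_squared[of w v] y z
      by (simp_all add: D_def inner_commute)
    \<comment> \<open>\<open>t\<close> is split so that the addition theorem produces the terms of the expanded left-hand side\<close>
    have "great_circle z w (t - s) \<bullet> great_circle y v (- s) \<le> cos (s + (t - s))"
      using yv zw by (auto simp: unit_normals_def)
    then have "sin s * sin (t - s) * (1 - v \<bullet> w) \<le> (cos s * cos (t - s)) * (1 - y \<bullet> z)
        + (- cos s * sin (t - s)) * (w \<bullet> y) + (sin s * cos (t - s)) * (v \<bullet> z)"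
      unfolding cos_add
      by (simp add: great_circle_def inner_add inner_diff inner_commute algebra_simps)
    also have "\<dots> \<le> 1 * (1 - y \<bullet> z) + 1 * \<bar>w \<bullet> y\<bar> + 1 * \<bar>v \<bullet> z\<bar>"
    proof -
      have scaled: "c * x \<le> 1 * \<bar>x\<bar>" if "\<bar>c\<bar> \<le> 1" for c x :: real
        using mult_right_mono[OF that abs_ge_zero[of x]] abs_ge_self[of "c * x"]
        by (simp add: abs_mult)
      have trig: "\<bar>a * b\<bar> \<le> 1" if "\<bar>a\<bar> \<le> 1" "\<bar>b\<bar> \<le> 1" for a b :: real
        using that by (simp add: abs_mult mult_le_one)
      have "\<bar>1 - y \<bullet> z\<bar> = 1 - y \<bullet> z"
        using abs_inner_unit_le_1[OF y(1) z(1)] by (simp add: abs_le_iff)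
      moreover have "(cos s * cos (t - s)) * (1 - y \<bullet> z) \<le> 1 * \<bar>1 - y \<bullet> z\<bar>"
        by (intro scaled trig) auto
      moreover have "(- cos s * sin (t - s)) * (w \<bullet> y) \<le> 1 * \<bar>w \<bullet> y\<bar>"
        by (intro scaled trig) auto
      moreover have "(sin s * cos (t - s)) * (v \<bullet> z) \<le> 1 * \<bar>v \<bullet> z\<bar>"
        by (intro scaled trig) auto
      ultimately show ?thesis by linarith
    qed
    also have "\<dots> \<le> D / 2 + C * D + C * D"
      using tangent'[OF yv zw] tangent'[OF zw yv] D(1) by (simp add: D_def norm_minus_commute)
    finally have "sin s * sin (t - s) * (norm (w - v))\<^sup>2 \<le> (1 + 4 * C) * D"
      unfolding D(2) by (simp add: algebra_simps)
    moreover have "m\<^sup>2 * (norm (w - v))\<^sup>2 \<le> sin s * sin (t - s) * (norm (w - v))\<^sup>2"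
      unfolding power2_eq_square[of m] using m by (intro mult_right_mono mult_mono) auto
    ultimately have "(norm (w - v))\<^sup>2 \<le> L2 * D"
      using m(1) by (simp add: L2_def field_simps)
    then have "norm (w - v) \<le> sqrt (L2 * D)"
      by (rule real_le_rsqrt)
    then show ?thesis by (simp add: D_def real_sqrt_mult)
  qed
  show thesis
    using that[of C "sqrt L2"] C tangent' lip by simp
qed

text \<open>The distance to \<open>K\<close> changes along the geodesic at the maximal rate \<open>1\<close>, so its three marked points
  have mutual distances exactly \<open>s\<close>, \<open>t - s\<close> and \<open>t\<close>. Equality in the triangle inequality puts them on
  one great circle.\<close>

lemma unit_normals_of_geodesic:
  assumes \<gamma>: "unit_speed_geodesic_on {s - t..s} \<gamma>"
    and dist: "\<And>r. r \<in> {s - t..s} \<Longrightarrow> sphere_infdist (\<gamma> r) K = s - r"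
  obtains v where "(\<gamma> 0, v) \<in> unit_normals K s t"
proof -
  define y p q where "y = \<gamma> 0" and "p = \<gamma> s" and "q = \<gamma> (s - t)"
  have unit: "norm y = 1" "norm p = 1" "norm q = 1"
    using \<gamma> st by (auto simp: unit_speed_geodesic_on_def y_def p_def q_def)
  have u: "sphere_infdist y K = s" "sphere_infdist p K = 0" "sphere_infdist q K = t"
    using dist[of 0] dist[of s] dist[of "s - t"] st by (auto simp: y_def p_def q_def)
  have "p \<in> K"
    using sphere_infdist_attained[OF dim K unit(2)] u(2) sphere_angle_eq_0D[OF unit(2)] K(3)
    by (metis mem_sphere_0 subset_iff)
  have "sphere_angle y p \<le> s" "sphere_angle q y \<le> t - s" "sphere_angle q p \<le> t"
    using geodesic_sphere_angle_le[OF \<gamma>, of 0 s] geodesic_sphere_angle_le[OF \<gamma>, of "s - t" 0]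
      geodesic_sphere_angle_le[OF \<gamma>, of "s - t" s] st by (auto simp: y_def p_def q_def)
  then have "sphere_angle y p = s" "sphere_angle q y = t - s" "sphere_angle q p = t"
    using infdist_le[OF unit(1) \<open>p \<in> K\<close>] infdist_le[OF unit(3) \<open>p \<in> K\<close>]
      infdist_triangle[OF unit(3,1)] u by auto
  then have inner: "y \<bullet> p = cos s" "q \<bullet> y = cos (t - s)" "q \<bullet> p = cos t"
    using cos_sphere_angle unit by metis+
  have sin: "sin s > 0" using st by (intro sin_gt_zero) auto
  define v where "v = (1 / sin s) *\<^sub>R (cos s *\<^sub>R y - p)"
  have p_eq: "p = great_circle y v (- s)"
    using sin by (simp add: v_def great_circle_def)
  have yv: "y \<bullet> v = 0"
    using unit(1) by (simp add: v_def inner_diff_right inner dot_square_norm)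
  have "(norm (cos s *\<^sub>R y - p))\<^sup>2 = (sin s)\<^sup>2"
  proof -
    have "(norm (cos s *\<^sub>R y - p))\<^sup>2 = (cos s)\<^sup>2 * (y \<bullet> y) - 2 * cos s * (y \<bullet> p) + p \<bullet> p"
      unfolding power2_norm_eq_inner
      by (simp add: inner_diff inner_commute power2_eq_square algebra_simps)
    then show ?thesis
      using unit unfolding norm_eq_1 sin_squared_eq by (simp add: inner power2_eq_square)
  qed
  then have "norm (cos s *\<^sub>R y - p) = sin s"
    using sin by (simp add: power2_eq_iff_nonneg)
  then have v: "norm v = 1" using sin by (simp add: v_def)
  have "q \<bullet> v = (cos s * cos (t - s) - cos (s + (t - s))) / sin s"
    by (simp add: v_def inner_diff_right inner)
  also have "\<dots> = sin (t - s)"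
    unfolding cos_add using sin by simp
  finally have "q \<bullet> great_circle y v (t - s) = 1"
    using sin_cos_squared_add3[of "t - s"] by (simp add: great_circle_def inner_add_right inner)
  then have "q = great_circle y v (t - s)"
    using norm_diff_unit_squared[OF unit(3) norm_great_circle[OF unit(1) v yv, of "t - s"]] by simp
  then have "(y, v) \<in> unit_normals K s t"
    using \<open>p \<in> K\<close> p_eq unit(1) v yv u(3) by (simp add: unit_normals_iff)
  then show thesis using that by (simp add: y_def)
qed

end

section \<open>Compactness of \<open>\<Gamma>\<^sub>s\<^sup>t\<close>\<close>

lemma sphere_boundary_eq:
  assumes "openin (top_of_set unit_sphere) \<Omega>"
  shows "sphere_boundary \<Omega> = (unit_sphere \<inter> closure \<Omega>) - \<Omega>"
proof -
  have "\<Omega> \<subseteq> unit_sphere" using assms by (rule openin_imp_subset)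
  then show ?thesis
    using assms unfolding sphere_boundary_def frontier_of_def
    by (simp add: closure_of_subtopology interior_of_openin Int_absorb1)
qed

lemma compact_sphere_boundary: "compact (sphere_boundary \<Omega>)"
  unfolding sphere_boundary_def
  by (rule closedin_compact[OF compact_sphere closedin_frontier_of])

lemma sphere_boundary_subset: "sphere_boundary \<Omega> \<subseteq> unit_sphere"
  unfolding sphere_boundary_def
  by (rule closedin_imp_subset[OF closedin_frontier_of])

text \<open>The geodesic in the definition of \<open>\<Gamma>\<^sub>s\<^sup>t\<close> starts on the far side and runs towards the
  boundary, opposite to the gradient; hence the great circle in direction \<open>- v\<close>.\<close>

lemma Gamma_set_eq:
  fixes \<Omega> :: "'a::euclidean_space set"
  assumes dim: "2 \<le> DIM('a)" and bd: "sphere_boundary \<Omega> \<noteq> {}"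
    and st: "0 < s" "s < t" "t < pi"
  shows "Gamma_set \<Omega> s t = \<Omega> \<inter> fst ` unit_normals (sphere_boundary \<Omega>) s t"
proof -
  note K = compact_sphere_boundary bd sphere_boundary_subset
  show ?thesis
  proof (intro equalityI subsetI)
    fix y
    assume "y \<in> Gamma_set \<Omega> s t"
    then obtain \<gamma> where "y \<in> \<Omega>" and \<gamma>: "unit_speed_geodesic_on {s - t..s} \<gamma>" "\<gamma> 0 = y"
        "\<And>r. r \<in> {s - t..s} \<Longrightarrow> sphere_infdist (\<gamma> r) (sphere_boundary \<Omega>) = s - r"
      unfolding Gamma_set_def boundary_dist_def by blast
    then obtain v where "(y, v) \<in> unit_normals (sphere_boundary \<Omega>) s t"
      using unit_normals_of_geodesic[OF dim K st \<gamma>(1,3)] \<gamma>(2) by blast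
    then show "y \<in> \<Omega> \<inter> fst ` unit_normals (sphere_boundary \<Omega>) s t"
      using \<open>y \<in> \<Omega>\<close> by force
  next
    fix y
    assume "y \<in> \<Omega> \<inter> fst ` unit_normals (sphere_boundary \<Omega>) s t"
    then obtain v where "y \<in> \<Omega>" and yv: "(y, v) \<in> unit_normals (sphere_boundary \<Omega>) s t"
      by auto
    have y: "norm y = 1" "norm v = 1" "y \<bullet> v = 0"
      using yv by (auto simp: unit_normals_def)
    have "boundary_dist \<Omega> (great_circle y (- v) r) = s - r" if "r \<in> {s - t..s}" for r
      unfolding boundary_dist_def great_circle_reverse
      using sphere_infdist_along_normal[OF dim K st yv, of "- r"] that by simp
    moreover have "unit_speed_geodesic_on {s - t..s} (great_circle y (- v))"
      using y by (intro unit_speed_geodesic_great_circle) simp_all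
    moreover from calculation(1)[of 0] have "boundary_dist \<Omega> y = s"
      using st by simp
    ultimately show "y \<in> Gamma_set \<Omega> s t"
      using \<open>y \<in> \<Omega>\<close> great_circle_0 unfolding Gamma_set_def by blast
  qed
qed

text \<open>\<open>\<Omega>\<close> may be replaced by its closure, as the points of \<open>\<Gamma>\<^sub>s\<^sup>t\<close> stay at distance \<open>s > 0\<close> from
  the boundary of \<open>\<Omega>\<close>.\<close>

lemma compact_Gamma_set:
  fixes \<Omega> :: "'a::euclidean_space set"
  assumes dim: "2 \<le> DIM('a)" and \<Omega>: "openin (top_of_set unit_sphere) \<Omega>"
    and bd: "sphere_boundary \<Omega> \<noteq> {}" and st: "0 < s" "s < t" "t < pi"
  shows "compact (Gamma_set \<Omega> s t)"
proof -
  note K = compact_sphere_boundary bd sphere_boundary_subset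
  let ?P = "unit_normals (sphere_boundary \<Omega>) s t"
  have inside: "y \<in> \<Omega>" if "y \<in> closure \<Omega>" "(y, v) \<in> ?P" for y v
  proof (rule ccontr)
    assume "y \<notin> \<Omega>"
    have y: "norm y = 1" using that(2) by (auto simp: unit_normals_def)
    then have "y \<in> sphere_boundary \<Omega>"
      using \<open>y \<notin> \<Omega>\<close> that(1) by (simp add: sphere_boundary_eq[OF \<Omega>])
    then have "sphere_infdist y (sphere_boundary \<Omega>) \<le> 0"
      using sphere_infdist_le_angle[OF dim K y] sphere_angle_self[OF y] by metis
    then show False
      using sphere_infdist_along_normal[OF dim K st that(2), of 0] st by simp
  qed
  have "Gamma_set \<Omega> s t = closure \<Omega> \<inter> fst ` ?P"
    unfolding Gamma_set_eq[OF dim bd st]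
  proof (intro equalityI subsetI IntI; elim IntE)
    show "y \<in> \<Omega>" if "y \<in> closure \<Omega>" "y \<in> fst ` ?P" for y
      using that(2) inside[OF that(1)] by (metis imageE prod.collapse)
  qed (use closure_subset in blast)+
  moreover have "compact (fst ` ?P)"
    by (intro compact_continuous_image continuous_intros compact_unit_normals K(1))
  ultimately show ?thesis
    by (simp add: closed_Int_compact)
qed

section \<open>Extension of one-jets to \<open>C\<^sup>1\<^sup>,\<^sup>1\<close> functions\<close>

text \<open>Separate the strict epigraph from the point of the graph over \<open>x\<close>. The separating hyperplane is not
  vertical because the function is finite on both sides of \<open>x\<close> in every direction.\<close>

lemma convex_on_UNIV_subgradient:
  fixes F :: "'a::euclidean_space \<Rightarrow> real"
  assumes F: "convex_on UNIV F"
  obtains g where "\<And>z. F x + g \<bullet> (z - x) \<le> F z"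
proof -
  let ?S = "{(z, v). F z < v}"
  have "convex ?S"
  proof (rule convexI)
    fix p q :: "'a \<times> real" and a b :: real
    assume pq: "p \<in> ?S" "q \<in> ?S" and ab: "0 \<le> a" "0 \<le> b" "a + b = 1"
    obtain z v z' v' where pq': "p = (z, v)" "q = (z', v')" "F z < v" "F z' < v'"
      using pq by auto
    have "F (a *\<^sub>R z + b *\<^sub>R z') \<le> a * F z + b * F z'"
      using F ab by (simp add: convex_on_def)
    also have "\<dots> < a * v + b * v'"
      using pq' ab
      by (cases "a = 0") (auto intro!: add_less_le_mono mult_left_mono mult_strict_left_mono)
    finally show "a *\<^sub>R p + b *\<^sub>R q \<in> ?S" by (simp add: pq')
  qed
  moreover have "(x, F x + 1) \<in> ?S" by simp
  then have "?S \<noteq> {}" by blast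
  ultimately obtain c \<beta> where c: "c \<noteq> 0" "\<And>p. p \<in> {(x, F x)} \<Longrightarrow> c \<bullet> p \<le> \<beta>"
      "\<And>p. p \<in> ?S \<Longrightarrow> \<beta> \<le> c \<bullet> p"
    using separating_hyperplane_sets[of "{(x, F x)}" ?S] by auto
  obtain a \<alpha> where c_eq: "c = (a, \<alpha>)" by force
  have sep: "a \<bullet> x + \<alpha> * F x \<le> a \<bullet> z + \<alpha> * v" if "F z < v" for z v
    using c(2)[of "(x, F x)"] c(3)[of "(z, v)"] that by (simp add: c_eq)
  \<comment> \<open>the epigraph is unbounded upwards\<close>
  have "\<alpha> \<ge> 0"
    using sep[of x "F x + 1"] by (simp add: algebra_simps)
  moreover have "\<alpha> \<noteq> 0"
  proof
    assume "\<alpha> = 0"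
    then have "a \<bullet> a \<le> 0"
      using sep[of "x - a" "F (x - a) + 1"] by (simp add: inner_diff_right)
    then have "a = 0" using inner_gt_zero_iff[of a] by linarith
    then show False using c(1) \<open>\<alpha> = 0\<close> by (simp add: c_eq zero_prod_def)
  qed
  ultimately have "\<alpha> > 0" by simp
  show thesis
  proof (rule that[of "- (a /\<^sub>R \<alpha>)"])
    fix z
    have "(a \<bullet> x + \<alpha> * F x - a \<bullet> z) / \<alpha> \<le> v" if "F z < v" for v
      using sep[OF that] \<open>\<alpha> > 0\<close> by (simp add: field_simps)
    then have "(a \<bullet> x + \<alpha> * F x - a \<bullet> z) / \<alpha> \<le> F z"
      by (rule dense_ge)
    then show "F x + - (a /\<^sub>R \<alpha>) \<bullet> (z - x) \<le> F z"
      using \<open>\<alpha> > 0\<close> by (simp add: field_simps inner_diff_right)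
  qed
qed

lemma GDERIV_of_quadratic_remainder:
  assumes "\<And>h. \<bar>F (x + h) - F x - g \<bullet> h\<bar> \<le> K * (norm h)\<^sup>2"
  shows "GDERIV F x :> g"
  unfolding gderiv_def has_derivative_at
proof (intro conjI)
  show "bounded_linear (\<lambda>h. h \<bullet> g)" by (rule bounded_linear_inner_left)
  show "(\<lambda>h. norm (F (x + h) - F x - h \<bullet> g) / norm h) \<midarrow>0\<rightarrow> 0"
  proof (rule Lim_null_comparison)
    have "norm (norm (F (x + h) - F x - h \<bullet> g) / norm h) \<le> K * norm h" if "h \<noteq> 0" for h
      using assms[of h] that by (simp add: inner_commute divide_simps power2_eq_square mult_ac)
    then show "\<forall>\<^sub>F h in at 0. norm (norm (F (x + h) - F x - h \<bullet> g) / norm h) \<le> K * norm h"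
      by (auto simp: eventually_at_filter)
    show "((\<lambda>h. K * norm h) \<longlongrightarrow> 0) (at 0)"
      by (auto intro!: tendsto_eq_intros)
  qed
qed

text \<open>Expand the value at \<open>y + h\<close> around \<open>x\<close> and around \<open>y\<close>, where \<open>h\<close> has length \<open>\<bar>y - x\<bar>\<close> and points along
  \<open>g y - g x\<close>. The remainders sum to at most \<open>(4 + 1 + 1) K \<bar>y - x\<bar>\<^sup>2\<close>.\<close>

lemma lipschitz_of_quadratic_remainder:
  fixes F :: "'a::real_inner \<Rightarrow> real"
  assumes rem: "\<And>x h. \<bar>F (x + h) - F x - g x \<bullet> h\<bar> \<le> K * (norm h)\<^sup>2" and K: "K \<ge> 0"
  shows "norm (g x - g y) \<le> 6 * K * norm (x - y)"
proof (cases "g x = g y")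
  case False
  define r where "r = norm (y - x)"
  define h where "h = (r / norm (g y - g x)) *\<^sub>R (g y - g x)"
  have r: "0 \<le> r" by (simp add: r_def)
  have h: "norm h = r" using False r by (simp add: h_def)
  have "\<bar>F (x + (y - x + h)) - F x - g x \<bullet> (y - x + h)\<bar> \<le> K * (2 * r)\<^sup>2"
  proof (rule order_trans[OF rem])
    have "norm (y - x + h) \<le> 2 * r"
      using norm_triangle_ineq[of "y - x" h] by (simp add: h r_def)
    then show "K * (norm (y - x + h))\<^sup>2 \<le> K * (2 * r)\<^sup>2"
      by (intro mult_left_mono power_mono K) simp_all
  qed
  moreover have "\<bar>F (x + (y - x)) - F x - g x \<bullet> (y - x)\<bar> \<le> K * r\<^sup>2"
    using rem[of x "y - x"] by (simp add: r_def)
  moreover have "\<bar>F (y + h) - F y - g y \<bullet> h\<bar> \<le> K * r\<^sup>2"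
    using rem[of y h] by (simp add: h)
  ultimately have "(g y - g x) \<bullet> h \<le> 6 * K * r\<^sup>2"
    by (simp add: inner_diff_left inner_add_right power_mult_distrib abs_le_iff)
  moreover have "(g y - g x) \<bullet> h = r * norm (g y - g x)"
    using False by (simp add: h_def dot_square_norm power2_eq_square)
  moreover have "r = 0 \<Longrightarrow> False" using False by (auto simp: r_def)
  ultimately have "norm (g y - g x) \<le> 6 * K * r"
    using r mult_le_cancel_left_pos[of r "norm (g y - g x)" "6 * K * r"]
    by (cases "r = 0") (auto simp: power2_eq_square mult_ac)
  then show ?thesis by (simp add: r_def norm_minus_commute)
qed (use K in simp)

text \<open>A subgradient bounds the function from below at \<open>x + h\<close> and at \<open>x - h\<close>. Semiconcavity turns the
  second bound into an upper bound at \<open>x + h\<close>.\<close>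

lemma convex_on_quadratic_remainder:
  fixes F :: "'a::euclidean_space \<Rightarrow> real"
  assumes conv: "convex_on UNIV F"
    and semi: "\<And>x h. F (x + h) + F (x - h) \<le> 2 * F x + K * (norm h)\<^sup>2"
  obtains g where "\<And>x h. \<bar>F (x + h) - F x - g x \<bullet> h\<bar> \<le> K * (norm h)\<^sup>2"
proof -
  have "\<exists>g. \<forall>z. F x + g \<bullet> (z - x) \<le> F z" for x
    using convex_on_UNIV_subgradient[OF conv, of x] by metis
  then obtain g where g: "\<And>x z. F x + g x \<bullet> (z - x) \<le> F z" by metis
  show thesis
  proof (rule that)
    fix x h
    show "\<bar>F (x + h) - F x - g x \<bullet> h\<bar> \<le> K * (norm h)\<^sup>2"
      using g[of x "x + h"] g[of x "x - h"] semi[of x h] by (simp add: abs_le_iff)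
  qed
qed

lemma gradient_of_affine_support:
  fixes F :: "'a::real_inner \<Rightarrow> real"
  assumes rem: "\<And>h. F (x + h) - F x - g \<bullet> h \<le> K * (norm h)\<^sup>2" and K: "K \<ge> 0"
    and supp: "\<And>h. F x + w \<bullet> h \<le> F (x + h)"
  shows "g = w"
proof (rule ccontr)
  assume "g \<noteq> w"
  define e where "e = (norm (w - g))\<^sup>2"
  have e: "e > 0" using \<open>g \<noteq> w\<close> by (simp add: e_def)
  \<comment> \<open>a step along \<open>w - g\<close> so short that the quadratic term loses to the linear one\<close>
  define \<tau> where "\<tau> = 1 / (K + 1)"
  have \<tau>: "\<tau> > 0" "K * \<tau> < 1" using K by (simp_all add: \<tau>_def field_simps)
  have "(w - g) \<bullet> (\<tau> *\<^sub>R (w - g)) \<le> K * (norm (\<tau> *\<^sub>R (w - g)))\<^sup>2"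
    using rem[of "\<tau> *\<^sub>R (w - g)"] supp[of "\<tau> *\<^sub>R (w - g)"]
    unfolding inner_diff_left[of w g] by linarith
  then have "\<tau> * e \<le> (K * \<tau>) * (\<tau> * e)"
    using \<tau> by (simp add: e_def dot_square_norm power_mult_distrib power2_eq_square mult_ac)
  moreover have "(K * \<tau>) * (\<tau> * e) < 1 * (\<tau> * e)"
    using \<tau> e by (intro mult_strict_right_mono) simp_all
  ultimately show False by simp
qed

text \<open>The lower boundary of the convex hull of \<open>Q\<close>, which stands for the union of the epigraphs of a
  family of functions. Semiconcavity passes from \<open>Q\<close> to its hull because the points \<open>(x, v)\<close>
  for which the hull has points over \<open>x + h\<close> and \<open>x - h\<close> with heights adding up to at most
  \<open>2 v + K \<bar>h\<bar>\<^sup>2\<close> form a convex set containing \<open>Q\<close>. Working with the hull as a set avoids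
  convex combinations of arbitrary length.\<close>

lemma convex_envelope_between:
  fixes Q :: "('a::real_inner \<times> real) set" and \<phi> :: "'a \<Rightarrow> real"
  assumes nonempty: "\<And>x. \<exists>v. (x, v) \<in> Q"
    and \<phi>: "convex_on UNIV \<phi>" and above: "\<And>x v. (x, v) \<in> Q \<Longrightarrow> \<phi> x \<le> v"
    and semi: "\<And>x v h. (x, v) \<in> Q \<Longrightarrow>
      \<exists>v1 v2. (x + h, v1) \<in> Q \<and> (x - h, v2) \<in> Q \<and> v1 + v2 \<le> 2 * v + K * (norm h)\<^sup>2"
  obtains F where "convex_on UNIV F"
    "\<And>x h. F (x + h) + F (x - h) \<le> 2 * F x + K * (norm h)\<^sup>2"
    "\<And>x. \<phi> x \<le> F x" "\<And>x v. (x, v) \<in> Q \<Longrightarrow> F x \<le> v"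
proof -
  define S where "S = convex hull Q"
  have S: "convex S" by (simp add: S_def)
  have QS: "Q \<subseteq> S" by (simp add: S_def hull_subset)
  have "S \<subseteq> epigraph UNIV \<phi>"
    unfolding S_def
  proof (rule hull_minimal)
    show "Q \<subseteq> epigraph UNIV \<phi>" using above by (auto simp: epigraph_def)
  qed (rule convex_epigraphI[OF \<phi>])
  then have above_S: "\<phi> x \<le> v" if "(x, v) \<in> S" for x v
    using that by (auto simp: epigraph_def)
  define F where "F x = Inf {v. (x, v) \<in> S}" for x
  have ne: "{v. (x, v) \<in> S} \<noteq> {}" for x
    using nonempty[of x] QS by blast
  have bdd: "bdd_below {v. (x, v) \<in> S}" for x
    using above_S by (intro bdd_belowI[of _ "\<phi> x"]) simp
  have F_le: "F x \<le> v" if "(x, v) \<in> S" for x v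
    unfolding F_def using that bdd by (intro cInf_lower) simp_all
  have F_approx: "\<exists>v. (x, v) \<in> S \<and> v < F x + e" if "e > 0" for x e
    using cInf_lessD[OF ne[of x], of "F x + e"] that by (auto simp: F_def)
  have semi_S: "\<exists>v1 v2. (fst p + h, v1) \<in> S \<and> (fst p - h, v2) \<in> S
      \<and> v1 + v2 \<le> 2 * snd p + K * (norm h)\<^sup>2" if "p \<in> S" for p h
  proof -
    let ?T = "{p. \<exists>v1 v2. (fst p + h, v1) \<in> S \<and> (fst p - h, v2) \<in> S
      \<and> v1 + v2 \<le> 2 * snd p + K * (norm h)\<^sup>2}"
    have "convex ?T"
    proof (rule convexI)
      fix p q and a b :: real
      assume p: "p \<in> ?T" and q: "q \<in> ?T" and ab: "0 \<le> a" "0 \<le> b" "a + b = 1"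
      obtain v1 v2 where v: "(fst p + h, v1) \<in> S" "(fst p - h, v2) \<in> S"
        "v1 + v2 \<le> 2 * snd p + K * (norm h)\<^sup>2" using p by auto
      obtain w1 w2 where w: "(fst q + h, w1) \<in> S" "(fst q - h, w2) \<in> S"
        "w1 + w2 \<le> 2 * snd q + K * (norm h)\<^sup>2" using q by auto
      have b: "b = 1 - a" using ab by simp
      have "(fst (a *\<^sub>R p + b *\<^sub>R q) + h, a * v1 + b * w1) \<in> S"
        using convexD[OF S v(1) w(1) ab] by (simp add: algebra_simps b)
      moreover have "(fst (a *\<^sub>R p + b *\<^sub>R q) - h, a * v2 + b * w2) \<in> S"
        using convexD[OF S v(2) w(2) ab] by (simp add: algebra_simps b)
      moreover have "(a * v1 + b * w1) + (a * v2 + b * w2)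
          \<le> 2 * snd (a *\<^sub>R p + b *\<^sub>R q) + K * (norm h)\<^sup>2"
        using mult_left_mono[OF v(3) ab(1)] mult_left_mono[OF w(3) ab(2)]
        by (simp add: algebra_simps b)
      ultimately show "a *\<^sub>R p + b *\<^sub>R q \<in> ?T" by blast
    qed
    moreover have "Q \<subseteq> ?T"
      using semi QS by fastforce
    ultimately have "S \<subseteq> ?T" unfolding S_def by (intro hull_minimal)
    then show ?thesis using that by blast
  qed
  show thesis
  proof (rule that)
    show "convex_on UNIV F"
    proof (rule convex_onI)
      fix a :: real and x y :: 'a
      assume a: "0 < a" "a < 1"
      show "F ((1 - a) *\<^sub>R x + a *\<^sub>R y) \<le> (1 - a) * F x + a * F y"
      proof (rule field_le_epsilon)
        fix e :: real
        assume "e > 0"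
        obtain v w where v: "(x, v) \<in> S" "v < F x + e" and w: "(y, w) \<in> S" "w < F y + e"
          using F_approx[OF \<open>e > 0\<close>] by meson
        have "F ((1 - a) *\<^sub>R x + a *\<^sub>R y) \<le> (1 - a) * v + a * w"
          using convexD[OF S v(1) w(1), of "1 - a" a] a by (intro F_le) simp
        also have "\<dots> \<le> (1 - a) * (F x + e) + a * (F y + e)"
          using v w a by (intro add_mono mult_left_mono) simp_all
        finally show "F ((1 - a) *\<^sub>R x + a *\<^sub>R y) \<le> (1 - a) * F x + a * F y + e"
          by (simp add: algebra_simps)
      qed
    qed simp
    show "F (x + h) + F (x - h) \<le> 2 * F x + K * (norm h)\<^sup>2" for x h
    proof (rule field_le_epsilon)
      fix e :: real
      assume "e > 0"
      then obtain v where v: "(x, v) \<in> S" "v < F x + e / 2"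
        using F_approx[of "e / 2"] by auto
      obtain v1 v2 where "(x + h, v1) \<in> S" "(x - h, v2) \<in> S" "v1 + v2 \<le> 2 * v + K * (norm h)\<^sup>2"
        using semi_S[OF v(1), of h] by auto
      then show "F (x + h) + F (x - h) \<le> 2 * F x + K * (norm h)\<^sup>2 + e"
        using F_le[of "x + h" v1] F_le[of "x - h" v2] v(2) by simp
    qed
    show "\<phi> x \<le> F x" for x
      unfolding F_def using above_S ne by (intro cInf_greatest) simp_all
    show "F x \<le> v" if "(x, v) \<in> Q" for x v
      using that QS F_le by blast
  qed
qed

text \<open>This is the construction of Azagra, Le Gruyer and Mudarra. Each \<open>y\<close> in \<open>E\<close> prescribes a paraboloid
  \<open>f y + G y \<bullet> (x - y) + c \<bar>x - y\<bar>\<^sup>2\<close> above the extension, and one below it with \<open>- c\<close>; for \<open>c\<close> large the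
  upper ones stay above the lower ones. After adding \<open>c \<bar>x\<bar>\<^sup>2\<close> the lower ones become affine, and
  the convex envelope of the upper ones lies between the two families. At a point of \<open>E\<close> it is
  pinched, so it has the prescribed value and gradient. Subtracting \<open>c \<bar>x\<bar>\<^sup>2\<close> gives the extension.\<close>

theorem whitney_extension_C11:
  fixes f :: "'a::euclidean_space \<Rightarrow> real" and G :: "'a \<Rightarrow> 'a"
  assumes "E \<noteq> {}" and "C \<ge> 0" "L \<ge> 0"
    and jet: "\<And>y z. \<lbrakk>y \<in> E; z \<in> E\<rbrakk> \<Longrightarrow> \<bar>f z - f y - G y \<bullet> (z - y)\<bar> \<le> C * (norm (z - y))\<^sup>2"
    and lip: "\<And>y z. \<lbrakk>y \<in> E; z \<in> E\<rbrakk> \<Longrightarrow> norm (G z - G y) \<le> L * norm (z - y)"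
  obtains F g B where "\<And>x. GDERIV F x :> g x" "B-lipschitz_on UNIV g"
    "\<And>y. y \<in> E \<Longrightarrow> F y = f y \<and> g y = G y"
proof -
  \<comment> \<open>\<open>C\<close> and \<open>L\<close> each have to be doubled because \<open>(a + b)\<^sup>2 \<le> 2 (a\<^sup>2 + b\<^sup>2)\<close>\<close>
  define c where "c = 2 * (C + L)"
  have c: "c \<ge> 0" using assms by (simp add: c_def)
  define up where "up y x = f y + G y \<bullet> (x - y) + c * (norm (x - y))\<^sup>2 + c * (norm x)\<^sup>2" for x y
  define low where "low z x = f z + G z \<bullet> (x - z) - c * (norm (x - z))\<^sup>2 + c * (norm x)\<^sup>2" for x z
  have low_affine: "low z x = (G z + (2 * c) *\<^sub>R z) \<bullet> x + (f z - G z \<bullet> z - c * (norm z)\<^sup>2)" for z x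
    unfolding low_def power2_norm_eq_inner by (simp add: inner_simps inner_commute algebra_simps)
  have low_le_up: "low z x \<le> up y x" if yz: "y \<in> E" "z \<in> E" for x y z
  proof -
    define a b r where "a = norm (x - z)" and "b = norm (x - y)" and "r = norm (z - y)"
    have nonneg: "0 \<le> a" "0 \<le> b" "0 \<le> r" by (simp_all add: a_def b_def r_def)
    have r: "r \<le> a + b"
      using norm_triangle_ineq4[of "x - y" "x - z"] by (simp add: a_def b_def r_def)
    have sq: "(a + b)\<^sup>2 \<le> 2 * (a\<^sup>2 + b\<^sup>2)"
      using sum_squares_bound[of a b] by (simp add: power2_sum)
    have "f z - f y - G y \<bullet> (z - y) \<le> C * (2 * (a\<^sup>2 + b\<^sup>2))"
    proof -
      have "r\<^sup>2 \<le> 2 * (a\<^sup>2 + b\<^sup>2)"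
        using power_mono[OF r nonneg(3), of 2] sq by simp
      then have "C * r\<^sup>2 \<le> C * (2 * (a\<^sup>2 + b\<^sup>2))"
        using \<open>C \<ge> 0\<close> by (intro mult_left_mono)
      then show ?thesis using jet[OF yz] by (simp add: r_def)
    qed
    moreover have "(G z - G y) \<bullet> (x - z) \<le> L * (2 * (a\<^sup>2 + b\<^sup>2))"
    proof -
      have "(G z - G y) \<bullet> (x - z) \<le> norm (G z - G y) * a"
        using norm_cauchy_schwarz[of "G z - G y" "x - z"] by (simp add: a_def)
      also have "\<dots> \<le> (L * r) * a"
        using lip[OF yz] nonneg by (intro mult_right_mono) (simp_all add: r_def)
      also have "\<dots> \<le> (L * (a + b)) * (a + b)"
        using r nonneg \<open>L \<ge> 0\<close> by (intro mult_mono) simp_all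
      also have "\<dots> \<le> L * (2 * (a\<^sup>2 + b\<^sup>2))"
        using mult_left_mono[OF sq \<open>L \<ge> 0\<close>] by (simp add: power2_eq_square mult_ac)
      finally show ?thesis .
    qed
    ultimately have "f z + G z \<bullet> (x - z) - (f y + G y \<bullet> (x - y)) \<le> c * (a\<^sup>2 + b\<^sup>2)"
      by (simp add: c_def inner_diff_left inner_diff_right algebra_simps)
    then show ?thesis
      by (simp add: low_def up_def a_def b_def algebra_simps)
  qed
  define Q where "Q = {(x, v). \<exists>y\<in>E. up y x \<le> v}"
  obtain y0 where y0: "y0 \<in> E" using \<open>E \<noteq> {}\<close> by blast
  define \<phi> where "\<phi> x = (SUP z\<in>E. low z x)" for x
  have bdd: "bdd_above ((\<lambda>z. low z x) ` E)" for x
    using low_le_up[OF y0] by (intro bdd_aboveI[of _ "up y0 x"]) auto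
  have low_le_\<phi>: "low z x \<le> \<phi> x" if "z \<in> E" for z x
    unfolding \<phi>_def using that bdd by (rule cSUP_upper)
  have "convex_on UNIV \<phi>"
  proof (rule convex_onI)
    fix a :: real and x y :: 'a
    assume a: "0 < a" "a < 1"
    show "\<phi> ((1 - a) *\<^sub>R x + a *\<^sub>R y) \<le> (1 - a) * \<phi> x + a * \<phi> y"
      unfolding \<phi>_def[of "(1 - a) *\<^sub>R x + a *\<^sub>R y"]
    proof (rule cSUP_least[OF \<open>E \<noteq> {}\<close>])
      fix z
      assume "z \<in> E"
      have "low z ((1 - a) *\<^sub>R x + a *\<^sub>R y) = (1 - a) * low z x + a * low z y"
        unfolding low_affine by (simp add: inner_add_right algebra_simps)
      also have "\<dots> \<le> (1 - a) * \<phi> x + a * \<phi> y"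
        using low_le_\<phi>[OF \<open>z \<in> E\<close>] a by (intro add_mono mult_left_mono) simp_all
      finally show "low z ((1 - a) *\<^sub>R x + a *\<^sub>R y) \<le> (1 - a) * \<phi> x + a * \<phi> y" .
    qed
  qed simp
  moreover have "\<phi> x \<le> v" if xv: "(x, v) \<in> Q" for x v
    unfolding \<phi>_def
  proof (rule cSUP_least[OF \<open>E \<noteq> {}\<close>])
    fix z
    assume "z \<in> E"
    obtain y where "y \<in> E" "up y x \<le> v" using xv by (auto simp: Q_def)
    then show "low z x \<le> v" using low_le_up[OF _ \<open>z \<in> E\<close>, of y x] by simp
  qed
  moreover have "\<exists>v1 v2. (x + h, v1) \<in> Q \<and> (x - h, v2) \<in> Q \<and> v1 + v2 \<le> 2 * v + (4 * c) * (norm h)\<^sup>2"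
    if xv: "(x, v) \<in> Q" for x v h
  proof -
    obtain y where y: "y \<in> E" "up y x \<le> v" using xv by (auto simp: Q_def)
    have "up y (x + h) + up y (x - h) = 2 * up y x + (4 * c) * (norm h)\<^sup>2"
      unfolding up_def power2_norm_eq_inner by (simp add: inner_simps inner_commute algebra_simps)
    then have "up y (x + h) + up y (x - h) \<le> 2 * v + (4 * c) * (norm h)\<^sup>2"
      using y(2) by simp
    moreover have "(x + h, up y (x + h)) \<in> Q" "(x - h, up y (x - h)) \<in> Q"
      using y(1) by (auto simp: Q_def)
    ultimately show ?thesis by blast
  qed
  moreover have "\<exists>v. (x, v) \<in> Q" for x
    using y0 by (auto simp: Q_def)
  ultimately obtain H where H: "convex_on UNIV H"
      "\<And>x h. H (x + h) + H (x - h) \<le> 2 * H x + (4 * c) * (norm h)\<^sup>2"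
      "\<And>x. \<phi> x \<le> H x" "\<And>x v. (x, v) \<in> Q \<Longrightarrow> H x \<le> v"
    using convex_envelope_between[of Q \<phi> "4 * c"] by blast
  obtain k where k: "\<And>x h. \<bar>H (x + h) - H x - k x \<bullet> h\<bar> \<le> 4 * c * (norm h)\<^sup>2"
    using convex_on_quadratic_remainder[OF H(1,2)] by blast
  have H_eq: "H y = f y + c * (norm y)\<^sup>2" if "y \<in> E" for y
  proof (rule antisym)
    show "H y \<le> f y + c * (norm y)\<^sup>2"
      using that by (intro H(4)) (auto simp: Q_def up_def intro!: bexI[of _ y])
    show "f y + c * (norm y)\<^sup>2 \<le> H y"
      using low_le_\<phi>[OF that, of y] H(3)[of y] by (simp add: low_def)
  qed
  have k_eq: "k y = G y + (2 * c) *\<^sub>R y" if "y \<in> E" for y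
  proof (rule gradient_of_affine_support)
    show "H (y + h) - H y - k y \<bullet> h \<le> 4 * c * (norm h)\<^sup>2" for h
      using k[of y h] by simp
    show "H y + (G y + (2 * c) *\<^sub>R y) \<bullet> h \<le> H (y + h)" for h
    proof -
      have "H y + (G y + (2 * c) *\<^sub>R y) \<bullet> h = low y (y + h)"
        unfolding H_eq[OF that] low_affine power2_norm_eq_inner
        by (simp add: inner_simps inner_commute algebra_simps)
      also have "\<dots> \<le> H (y + h)"
        using low_le_\<phi>[OF that, of "y + h"] H(3)[of "y + h"] by simp
      finally show ?thesis .
    qed
  qed (use c in simp)
  define F where "F x = H x - c * (norm x)\<^sup>2" for x
  define g where "g x = k x - (2 * c) *\<^sub>R x" for x
  show thesis
  proof (rule that)
    fix x
    have "\<bar>F (x + h) - F x - g x \<bullet> h\<bar> \<le> 5 * c * (norm h)\<^sup>2" for h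
    proof -
      have "F (x + h) - F x - g x \<bullet> h = (H (x + h) - H x - k x \<bullet> h) - c * (norm h)\<^sup>2"
        unfolding F_def g_def power2_norm_eq_inner by (simp add: inner_simps inner_commute algebra_simps)
      moreover have "0 \<le> c * (norm h)\<^sup>2" using c by simp
      ultimately show ?thesis using k[of x h] by linarith
    qed
    then show "GDERIV F x :> g x" by (rule GDERIV_of_quadratic_remainder)
  next
    show "(26 * c)-lipschitz_on UNIV g"
    proof (rule lipschitz_onI)
      fix x y
      have "norm (g x - g y) \<le> norm (k x - k y) + norm ((2 * c) *\<^sub>R (x - y))"
        using norm_triangle_ineq4[of "k x - k y" "(2 * c) *\<^sub>R (x - y)"]
        by (simp add: g_def algebra_simps)
      also have "\<dots> \<le> 6 * (4 * c) * norm (x - y) + 2 * c * norm (x - y)"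
        using lipschitz_of_quadratic_remainder[OF k, of x y] c by simp
      finally show "dist (g x) (g y) \<le> 26 * c * dist x y"
        by (simp add: dist_norm)
    qed (use c in simp)
  next
    fix y
    assume "y \<in> E"
    then show "F y = f y \<and> g y = G y"
      by (simp add: F_def g_def H_eq k_eq)
  qed
qed

text \<open>For a tangential field \<open>N\<close>, the first estimate is the Whitney condition for the jet with value \<open>0\<close> and
  gradient \<open>N\<close>, as \<open>N y \<bullet> (z - y) = N y \<bullet> z\<close>. The zero set of the extension has to be cut down to the
  open set where the tangential gradient does not vanish; this set contains \<open>E\<close>, where the gradient
  is \<open>N\<close>.\<close>

lemma subset_C11_hypersurface_of_sphere:
  fixes N :: "'a::euclidean_space \<Rightarrow> 'a"
  assumes E: "E \<subseteq> unit_sphere" and CL: "C \<ge> 0" "L \<ge> 0"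
    and N: "\<And>y. y \<in> E \<Longrightarrow> y \<bullet> N y = 0" "\<And>y. y \<in> E \<Longrightarrow> N y \<noteq> 0"
    and quad: "\<And>y z. \<lbrakk>y \<in> E; z \<in> E\<rbrakk> \<Longrightarrow> \<bar>N y \<bullet> z\<bar> \<le> C * (norm (z - y))\<^sup>2"
    and lip: "\<And>y z. \<lbrakk>y \<in> E; z \<in> E\<rbrakk> \<Longrightarrow> norm (N z - N y) \<le> L * norm (z - y)"
  obtains M where "C11_hypersurface_of_sphere M" "E \<subseteq> M"
proof (cases "E = {}")
  case True
  then show thesis
    using that[of "{}"] by (simp add: C11_hypersurface_of_sphere_def)
next
  case False
  obtain F g B where F: "\<And>x. GDERIV F x :> g x" and g: "B-lipschitz_on UNIV g"
    and E_eq: "\<And>y. y \<in> E \<Longrightarrow> F y = 0 \<and> g y = N y"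
    using whitney_extension_C11[OF False CL, of "\<lambda>_. 0" N] quad lip N(1)
    by (auto simp: inner_diff_right inner_commute)
  define W where "W = {x. g x - (g x \<bullet> x) *\<^sub>R x \<noteq> 0}"
  define M where "M = {x \<in> unit_sphere \<inter> W. F x = 0}"
  have "open W"
    unfolding W_def using lipschitz_on_continuous_on[OF g]
    by (intro open_Collect_neq continuous_intros) auto
  have "C11_hypersurface_of_sphere M"
    unfolding C11_hypersurface_of_sphere_def
  proof (intro conjI ballI)
    show "M \<subseteq> unit_sphere" by (auto simp: M_def)
    fix p
    assume "p \<in> M"
    have "B-lipschitz_on W g" using g by (rule lipschitz_on_subset) simp
    then show "\<exists>W f G L. open W \<and> p \<in> W \<and> (\<forall>x\<in>W. GDERIV f x :> G x) \<and> L-lipschitz_on W G \<and>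
        M \<inter> W = {x \<in> unit_sphere \<inter> W. f x = 0} \<and>
        (\<forall>x\<in>M \<inter> W. G x - (G x \<bullet> x) *\<^sub>R x \<noteq> 0)"
      using \<open>open W\<close> \<open>p \<in> M\<close> F
      by (intro exI[of _ W] exI[of _ F] exI[of _ g] exI[of _ B]) (auto simp: M_def W_def)
  qed
  moreover have "E \<subseteq> M"
    using E N E_eq by (auto simp: M_def W_def inner_commute)
  ultimately show thesis by (rule that)
qed

section \<open>The structure of \<open>\<Gamma>\<^sub>s\<^sup>t\<close>\<close>

lemma hausdorff_measure_empty: "hausdorff_measure d {} = 0"
proof -
  have "hausdorff_premeasure d \<delta> {} \<le> (0::ennreal)" if "\<delta> > 0" for \<delta> :: real
    unfolding hausdorff_premeasure_def
    by (rule INF_lower2[of "\<lambda>_. {}"]) (use that in auto)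
  then show ?thesis
    unfolding hausdorff_measure_def by (intro antisym SUP_least) auto
qed

theorem theorem1p4:
  fixes \<Omega> :: "(real ^ 'm) set" and n :: nat and s t :: real
  assumes "CARD('m) = n + 2"
    and "openin (top_of_set unit_sphere) \<Omega>" and "\<Omega> \<noteq> {}"
    and "sphere_boundary \<Omega> \<noteq> {}"
    and "0 < s" and "s < t" and "t < pi"
  shows "\<exists>U :: nat \<Rightarrow> (real ^ 'm) set.
           (\<forall>j. compact (U j) \<and> U j \<subseteq> Gamma_set \<Omega> s t) \<and>
           hausdorff_measure n (Gamma_set \<Omega> s t - (\<Union>j. U j)) = 0 \<and>
           (\<forall>j. \<exists>M. C11_hypersurface_of_sphere M \<and> U j \<subseteq> M) \<and>
           (\<forall>j. \<exists>L. L-lipschitz_on (U j) (sphere_gradient (boundary_dist \<Omega>)))"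
proof -
  have dim: "2 \<le> DIM(real ^ 'm)" using assms(1) by simp
  note K = compact_sphere_boundary \<open>sphere_boundary \<Omega> \<noteq> {}\<close> sphere_boundary_subset
  note st = \<open>0 < s\<close> \<open>s < t\<close> \<open>t < pi\<close>
  let ?\<Gamma> = "Gamma_set \<Omega> s t"
  define N where "N = sphere_gradient (boundary_dist \<Omega>)"
  have normal: "(y, N y) \<in> unit_normals (sphere_boundary \<Omega>) s t" if "y \<in> ?\<Gamma>" for y
  proof -
    obtain v where yv: "(y, v) \<in> unit_normals (sphere_boundary \<Omega>) s t"
      using \<open>y \<in> ?\<Gamma>\<close> unfolding Gamma_set_eq[OF dim K(2) st] by auto
    have "has_sphere_gradient (boundary_dist \<Omega>) v y"
      using unit_normals_has_sphere_gradient[OF dim K st yv] by (simp add: boundary_dist_def[abs_def])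
    then have "N y = v"
      unfolding N_def using yv by (intro sphere_gradient_eqI) (auto simp: unit_normals_def)
    then show ?thesis using yv by simp
  qed
  obtain C L where CL: "C \<ge> 0" "L \<ge> 0"
      "\<And>y z. \<lbrakk>y \<in> ?\<Gamma>; z \<in> ?\<Gamma>\<rbrakk> \<Longrightarrow> \<bar>N y \<bullet> z\<bar> \<le> C * (norm (z - y))\<^sup>2"
      "\<And>y z. \<lbrakk>y \<in> ?\<Gamma>; z \<in> ?\<Gamma>\<rbrakk> \<Longrightarrow> norm (N z - N y) \<le> L * norm (z - y)"
    using unit_normals_estimates[OF dim K st] normal by metis
  have N: "norm y = 1" "y \<bullet> N y = 0" "norm (N y) = 1" if "y \<in> ?\<Gamma>" for y
    using normal[OF that] by (auto simp: unit_normals_def)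
  then have "?\<Gamma> \<subseteq> unit_sphere" "\<And>y. y \<in> ?\<Gamma> \<Longrightarrow> N y \<noteq> 0"
    by fastforce+
  then obtain M where "C11_hypersurface_of_sphere M" "?\<Gamma> \<subseteq> M"
    using subset_C11_hypersurface_of_sphere[of ?\<Gamma> C L N] N(2) CL by blast
  moreover have "L-lipschitz_on ?\<Gamma> N"
    using CL(2,4) by (intro lipschitz_onI) (auto simp: dist_norm norm_minus_commute)
  ultimately show ?thesis
    unfolding N_def using compact_Gamma_set[OF dim assms(2) K(2) st] hausdorff_measure_empty
    by (intro exI[of _ "\<lambda>_. ?\<Gamma>"]) auto
qed

end
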